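(* Let $M$ be an $n$-manifold and let $W$ and $V$ be disjoint compact submanifolds of $M$ of any (possibly different) dimensions $\le n$, not necessarily properly embedded, for which the isotopy extension theorem applies (for example, smooth submanifolds with respect to some smooth structure). Then the following is a short exact sequence of mapping class groups: $$1\to \mathcal{H}_d(W)\to \mathcal{H}_x(W,V)\to \mathcal{H}_x(V)\to 1.$$ The first map is inclusion of an element of $\mathcal{H}_d(W)$ extended to $(W,V)$ by the identity on $V$; the second map is restriction.
   Context: Manifolds are compact and orientable; automorphisms (self-homeomorphisms) of manifolds, pairs and triples are orientation preserving (on each of the manifolds involved). $\mathcal{H}(\cdot)$ denotes the mapping class group, i.e. the group of isotopy classes of such automorphisms. $\mathcal{H}(M,W,V)$ is the mapping class group of the triple. $\mathcal{H}(W,V)\approx\mathcal{H}(W)\times\mathcal{H}(V)$ is the group of isotopy classes of pairs $(f,g)$ with $f$ an automorphism of $W$ and $g$ an automorphism of $V$. $\mathcal{H}_x(V)$ is the image of the restriction map $\mathcal{H}(M,W,V)\to\mathcal{H}(V)$. $\mathcal{H}_x(W,V)$ is the image of the restriction map $\mathcal{H}(M,W,V)\to\mathcal{H}(W,V)$. $\mathcal{H}_d(W)$ is the image of the restriction map $\mathcal{H}((M,W)\ \mathrm{rel}\ V)\to\mathcal{H}(W)$, where $\mathcal{H}((M,W)\ \mathrm{rel}\ V)$ is the group of isotopy classes of automorphisms of $(M,W)$ that are the identity on $V$. *)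

theory Defs
  imports "HOL-Homology.Homology_Groups" "HOL-Analysis.Abstract_Topological_Spaces"
    "HOL-Algebra.Bij" "HOL-Algebra.Coset"
begin

section \<open>Compact oriented topological manifolds with boundary\<close>

definition locally_modelled_at :: "'b topology \<Rightarrow> 'a topology \<Rightarrow> 'a \<Rightarrow> bool" where
  "locally_modelled_at E X x \<longleftrightarrow>
     (\<exists>U V. openin X U \<and> x \<in> U \<and> openin E V \<and>
        subtopology X U homeomorphic_space subtopology E V)"

text \<open>For \<open>n = 0\<close> the half space is the one-point space, since points of
  \<^term>\<open>Euclidean_space 0\<close> have all coordinates zero.\<close>

definition half_space :: "nat \<Rightarrow> (nat \<Rightarrow> real) topology" where
  "half_space n = subtopology (Euclidean_space n) {x. 0 \<le> x 0}"

definition compact_manifold :: "nat \<Rightarrow> 'a topology \<Rightarrow> bool" where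
  "compact_manifold n X \<longleftrightarrow>
     compact_space X \<and> Hausdorff_space X \<and> second_countable X \<and>
     (\<forall>x \<in> topspace X. locally_modelled_at (half_space n) X x)"

definition manifold_interior :: "nat \<Rightarrow> 'a topology \<Rightarrow> 'a set" where
  "manifold_interior n X = {x \<in> topspace X. locally_modelled_at (Euclidean_space n) X x}"

abbreviation local_homology :: "nat \<Rightarrow> 'a topology \<Rightarrow> 'a set \<Rightarrow> 'a chain set monoid" where
  "local_homology n X U \<equiv> relative_homology_group (int n) X (topspace X - U)"

text \<open>An orientation is a locally consistent choice of a generator of
  \<open>H\<^sub>n (X, X - {x})\<close> at every interior point \<open>x\<close>. Its values outside the manifold interior
  are irrelevant.\<close>

definition orientation :: "nat \<Rightarrow> 'a topology \<Rightarrow> ('a \<Rightarrow> 'a chain set) \<Rightarrow> bool" where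
  "orientation n X \<mu> \<longleftrightarrow>
     (\<forall>x \<in> manifold_interior n X.
        \<mu> x \<in> carrier (local_homology n X {x}) \<and>
        generate (local_homology n X {x}) {\<mu> x} = carrier (local_homology n X {x})) \<and>
     (\<forall>x \<in> manifold_interior n X. \<exists>U \<alpha>.
        openin X U \<and> x \<in> U \<and> U \<subseteq> manifold_interior n X \<and>
        \<alpha> \<in> carrier (local_homology n X U) \<and>
        (\<forall>y \<in> U. hom_induced (int n) X (topspace X - U) X (topspace X - {y}) id \<alpha> = \<mu> y))"

record 'a oriented_space =
  dimen :: nat
  topo :: "'a topology"
  orient :: "'a \<Rightarrow> 'a chain set"

abbreviation points :: "'a oriented_space \<Rightarrow> 'a set" where
  "points X \<equiv> topspace (topo X)"

definition compact_oriented_manifold :: "'a oriented_space \<Rightarrow> bool" where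
  "compact_oriented_manifold X \<longleftrightarrow>
     compact_manifold (dimen X) (topo X) \<and> orientation (dimen X) (topo X) (orient X)"

text \<open>No proper embedding, local flatness or compatibility of orientations is required.\<close>

definition compact_submanifold :: "'a oriented_space \<Rightarrow> 'a oriented_space \<Rightarrow> bool" where
  "compact_submanifold W M \<longleftrightarrow>
     compact_oriented_manifold W \<and> dimen W \<le> dimen M \<and>
     points W \<subseteq> points M \<and> topo W = subtopology (topo M) (points W)"


section \<open>Automorphisms\<close>

definition orientation_preserving :: "'a oriented_space \<Rightarrow> ('a \<Rightarrow> 'a) \<Rightarrow> bool" where
  "orientation_preserving X f \<longleftrightarrow>
     (\<forall>x \<in> manifold_interior (dimen X) (topo X).
        hom_induced (int (dimen X)) (topo X) (points X - {x}) (topo X) (points X - {f x}) f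
          (orient X x) = orient X (f x))"

text \<open>As in \<^const>\<open>Bij\<close>, self-maps are taken extensional, so that an automorphism is determined by
  its values on the manifold.\<close>

definition automorphisms :: "'a oriented_space \<Rightarrow> ('a \<Rightarrow> 'a) set" where
  "automorphisms X =
     {f \<in> extensional (points X). homeomorphic_map (topo X) (topo X) f \<and> orientation_preserving X f}"

definition pair_automorphisms ::
    "'a oriented_space \<Rightarrow> 'a oriented_space \<Rightarrow> ('a \<Rightarrow> 'a) set" where
  "pair_automorphisms M W =
     {f \<in> automorphisms M. f ` points W = points W \<and> restrict f (points W) \<in> automorphisms W}"

definition triple_automorphisms ::
    "'a oriented_space \<Rightarrow> 'a oriented_space \<Rightarrow> 'a oriented_space \<Rightarrow> ('a \<Rightarrow> 'a) set" where
  "triple_automorphisms M W V = pair_automorphisms M W \<inter> pair_automorphisms M V"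

definition rel_automorphisms ::
    "'a oriented_space \<Rightarrow> 'a oriented_space \<Rightarrow> 'a oriented_space \<Rightarrow> ('a \<Rightarrow> 'a) set" where
  "rel_automorphisms M W V = {f \<in> pair_automorphisms M W. \<forall>x \<in> points V. f x = x}"

definition automorphism_group :: "'a oriented_space \<Rightarrow> ('a \<Rightarrow> 'a) set \<Rightarrow> ('a \<Rightarrow> 'a) monoid" where
  "automorphism_group X A = (BijGroup (points X))\<lparr>carrier := A\<rparr>"


section \<open>Isotopy classes\<close>

text \<open>The isotopy relation on a set \<open>A\<close> of automorphisms: every stage of the isotopy lies in \<open>A\<close>.\<close>

definition isotopy_rel ::
    "'a oriented_space \<Rightarrow> ('a \<Rightarrow> 'a) set \<Rightarrow> (('a \<Rightarrow> 'a) \<times> ('a \<Rightarrow> 'a)) set" where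
  "isotopy_rel X A =
     {(f, g). f \<in> A \<and> g \<in> A \<and> homotopic_with (\<lambda>h. h \<in> A) (topo X) (topo X) f g}"

text \<open>The group of classes of a congruence \<open>r\<close> on a group \<open>G\<close>, with the product of sets as
  multiplication, as in \<^const>\<open>FactGroup\<close>.\<close>

definition class_group :: "'g monoid \<Rightarrow> ('g \<times> 'g) set \<Rightarrow> 'g set monoid" where
  "class_group G r = \<lparr>carrier = carrier G // r, mult = set_mult G, one = r `` {\<one>\<^bsub>G\<^esub>}\<rparr>"

text \<open>The map sending the class of \<open>x\<close> to the \<open>r\<close>-class of \<open>\<phi> x\<close>; it is well defined on classes
  whenever \<open>\<phi>\<close> respects the equivalence relations.\<close>

definition class_map :: "('h \<times> 'h) set \<Rightarrow> ('g \<Rightarrow> 'h) \<Rightarrow> 'g set \<Rightarrow> 'h set" where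
  "class_map r \<phi> C = r `` (\<phi> ` C)"

definition mcg_of :: "'a oriented_space \<Rightarrow> ('a \<Rightarrow> 'a) set \<Rightarrow> ('a \<Rightarrow> 'a) set monoid" where
  "mcg_of X A = class_group (automorphism_group X A) (isotopy_rel X A)"

abbreviation mcg_rel :: "'a oriented_space \<Rightarrow> (('a \<Rightarrow> 'a) \<times> ('a \<Rightarrow> 'a)) set" where
  "mcg_rel X \<equiv> isotopy_rel X (automorphisms X)"

definition mcg :: "'a oriented_space \<Rightarrow> ('a \<Rightarrow> 'a) set monoid" where
  "mcg X = mcg_of X (automorphisms X)"

definition mcg_triple ::
    "'a oriented_space \<Rightarrow> 'a oriented_space \<Rightarrow> 'a oriented_space \<Rightarrow> ('a \<Rightarrow> 'a) set monoid" where
  "mcg_triple M W V = mcg_of M (triple_automorphisms M W V)"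

definition mcg_pair_rel ::
    "'a oriented_space \<Rightarrow> 'a oriented_space \<Rightarrow> 'a oriented_space \<Rightarrow> ('a \<Rightarrow> 'a) set monoid" where
  "mcg_pair_rel M W V = mcg_of M (rel_automorphisms M W V)"

text \<open>\<open>\<H>(W, V)\<close>: isotopy classes of pairs of automorphisms.\<close>

definition mcg2_rel ::
    "'a oriented_space \<Rightarrow> 'a oriented_space \<Rightarrow>
     ((('a \<Rightarrow> 'a) \<times> ('a \<Rightarrow> 'a)) \<times> (('a \<Rightarrow> 'a) \<times> ('a \<Rightarrow> 'a))) set" where
  "mcg2_rel W V = {((f, g), (f', g')). (f, f') \<in> mcg_rel W \<and> (g, g') \<in> mcg_rel V}"

definition mcg2 ::
    "'a oriented_space \<Rightarrow> 'a oriented_space \<Rightarrow> (('a \<Rightarrow> 'a) \<times> ('a \<Rightarrow> 'a)) set monoid" where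
  "mcg2 W V =
     class_group
       (automorphism_group W (automorphisms W) \<times>\<times> automorphism_group V (automorphisms V))
       (mcg2_rel W V)"


section \<open>The groups and maps of the sequence\<close>

text \<open>\<open>\<H>\<^sub>x(V)\<close>, \<open>\<H>\<^sub>x(W, V)\<close> and \<open>\<H>\<^sub>d(W)\<close>: images of restriction maps.\<close>

definition Hx1 ::
    "'a oriented_space \<Rightarrow> 'a oriented_space \<Rightarrow> 'a oriented_space \<Rightarrow> ('a \<Rightarrow> 'a) set monoid" where
  "Hx1 M W V = (mcg V)\<lparr>carrier :=
     class_map (mcg_rel V) (\<lambda>f. restrict f (points V)) ` carrier (mcg_triple M W V)\<rparr>"

definition Hx2 ::
    "'a oriented_space \<Rightarrow> 'a oriented_space \<Rightarrow> 'a oriented_space \<Rightarrow>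
     (('a \<Rightarrow> 'a) \<times> ('a \<Rightarrow> 'a)) set monoid" where
  "Hx2 M W V = (mcg2 W V)\<lparr>carrier :=
     class_map (mcg2_rel W V) (\<lambda>f. (restrict f (points W), restrict f (points V)))
       ` carrier (mcg_triple M W V)\<rparr>"

definition Hd ::
    "'a oriented_space \<Rightarrow> 'a oriented_space \<Rightarrow> 'a oriented_space \<Rightarrow> ('a \<Rightarrow> 'a) set monoid" where
  "Hd M W V = (mcg W)\<lparr>carrier :=
     class_map (mcg_rel W) (\<lambda>f. restrict f (points W)) ` carrier (mcg_pair_rel M W V)\<rparr>"

definition extend_by_id ::
    "'a oriented_space \<Rightarrow> 'a oriented_space \<Rightarrow> ('a \<Rightarrow> 'a) set \<Rightarrow> (('a \<Rightarrow> 'a) \<times> ('a \<Rightarrow> 'a)) set" where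
  "extend_by_id W V = class_map (mcg2_rel W V) (\<lambda>f. (f, \<lambda>x \<in> points V. x))"

definition restrict_to_snd ::
    "'a oriented_space \<Rightarrow> (('a \<Rightarrow> 'a) \<times> ('a \<Rightarrow> 'a)) set \<Rightarrow> ('a \<Rightarrow> 'a) set" where
  "restrict_to_snd V = class_map (mcg_rel V) snd"

text \<open>The library's \<^const>\<open>short_exact_sequence\<close> forces all three groups to have the same element
  type, which is not the case here.\<close>

definition short_exact ::
    "'g monoid \<Rightarrow> 'h monoid \<Rightarrow> 'k monoid \<Rightarrow> ('g \<Rightarrow> 'h) \<Rightarrow> ('h \<Rightarrow> 'k) \<Rightarrow> bool" where
  "short_exact A B C i p \<longleftrightarrow>
     group_hom A B i \<and> group_hom B C p \<and>
     i \<in> mon A B \<and> p \<in> epi B C \<and> i ` carrier A = kernel B C p"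


section \<open>Isotopy extension\<close>

definition isotopy_from_id :: "'a topology \<Rightarrow> (real \<times> 'a \<Rightarrow> 'a) \<Rightarrow> bool" where
  "isotopy_from_id X h \<longleftrightarrow>
     continuous_map (prod_topology (top_of_set {0..1}) X) X h \<and>
     (\<forall>t \<in> {0..1}. homeomorphic_map X X (\<lambda>x. h (t, x))) \<and>
     (\<forall>x \<in> topspace X. h (0, x) = x)"

text \<open>Only isotopies of \<open>A\<close> through self-homeomorphisms of \<open>A\<close> have to extend. Extending all
  topological isotopies of embeddings of \<open>A\<close> in \<open>X\<close> would be a stronger demand, which fails already
  for smooth knots in the 3-sphere.\<close>

definition isotopy_extension :: "'a topology \<Rightarrow> 'a set \<Rightarrow> bool" where
  "isotopy_extension X A \<longleftrightarrow>
     (\<forall>h. isotopy_from_id (subtopology X A) h \<longrightarrow>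
        (\<exists>H. isotopy_from_id X H \<and> (\<forall>t \<in> {0..1}. \<forall>x \<in> A. H (t, x) = h (t, x))))"

end

theory Submission
  imports Defs
begin

text \<open>
  The only substantial point is exactness in the middle. Let \<open>f\<close> be an automorphism of the triple
  whose restriction to \<open>V\<close> is isotopic to the identity through \<open>k\<^sub>t\<close>. Then \<open>k\<^sub>t \<circ> (f|V)\<^sup>-\<^sup>1\<close> on \<open>V\<close>,
  together with the identity on \<open>W\<close>, is an isotopy of \<open>W \<union> V\<close> starting at the identity. If \<open>H\<^sub>t\<close>
  is an ambient extension, then \<open>H\<^sub>1 \<circ> f\<close> is the identity on \<open>V\<close> and agrees with \<open>f\<close> on \<open>W\<close>.
  The extension is only known to run through homeomorphisms, so one also has to see that \<open>H\<^sub>1\<close>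
  preserves the orientation; this is a connectedness argument along the track of each interior point.
\<close>

section \<open>Congruences on groups\<close>

text \<open>The orientation argument works with the abstract notion of orientation:
  \<open>H_n(X, X - {x})\<close> is never computed, and the only fact about it is that \<mu> x
  generates it. A class transported to a point of the track is therefore an integer power of the
  local orientation, with an exponent determined only modulo the order of the generator, rather than
  a sign. What rescues the argument is that every stage of the isotopy induces an isomorphism of
  local homology groups, so the generators at all points of one track have the same order. In the
  middle exactness, classes are compared in \<open>mcg2 W V\<close>, so no isotopy in M between f
  and \<open>H_1\<close> \<circ> f is involved: the two agree on W, and on V the hypothesis itself
  relates f to the identity. Automorphisms are extensional, whereas composites and ambient isotopies
  are not; constructions are carried out with plain functions and cut down by
  \<open>restrict\<close> at the end.\<close>

locale group_congruence = group G for G :: "'g monoid" (structure) and r +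
  assumes equiv: "equiv (carrier G) r"
    and mult_cong: "\<lbrakk>(a, b) \<in> r; (c, d) \<in> r\<rbrakk> \<Longrightarrow> (a \<otimes> c, b \<otimes> d) \<in> r"
begin

lemma related_carrier: "(a, b) \<in> r \<Longrightarrow> a \<in> carrier G \<and> b \<in> carrier G"
  using equiv by (auto simp: equiv_def)

lemma related_refl: "a \<in> carrier G \<Longrightarrow> (a, a) \<in> r"
  using equiv by (auto simp: equiv_def refl_on_def)

text \<open>Multiplying on the right by a reflexive pair, with \<open>inv a\<close> in one direction
  and \<open>a\<close> in the other, moves between the two sides. Hence the class of the identity
  determines the whole congruence, which is what makes it a coset relation.\<close>

lemma related_iff_quotient:
  assumes "a \<in> carrier G" "b \<in> carrier G"
  shows "(a, b) \<in> r \<longleftrightarrow> (\<one>, b \<otimes> inv a) \<in> r"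
proof
  assume "(a, b) \<in> r"
  then show "(\<one>, b \<otimes> inv a) \<in> r"
    using mult_cong [OF _ related_refl [of "inv a"], of a b] assms by simp
next
  assume "(\<one>, b \<otimes> inv a) \<in> r"
  then show "(a, b) \<in> r"
    using mult_cong [OF _ related_refl [of a], of \<one> "b \<otimes> inv a"] assms by (simp add: m_assoc)
qed

lemma normal_class_one: "r `` {\<one>} \<lhd> G"
proof (rule normal_invI)
  have sym: "(b, a) \<in> r" if "(a, b) \<in> r" for a b
    using equiv that by (meson equivE symD)
  show "subgroup (r `` {\<one>}) G"
  proof (rule subgroupI)
    show "r `` {\<one>} \<subseteq> carrier G"
      using related_carrier by blast
    show "r `` {\<one>} \<noteq> {}"
      using related_refl [OF one_closed] by blast
    show "inv a \<in> r `` {\<one>}" if "a \<in> r `` {\<one>}" for a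
    proof -
      have a: "(\<one>, a) \<in> r" "a \<in> carrier G"
        using that related_carrier [of \<one> a] by auto
      then have "(inv a \<otimes> \<one>, inv a \<otimes> a) \<in> r"
        by (intro mult_cong related_refl) auto
      then show ?thesis
        using a sym by simp
    qed
    show "a \<otimes> b \<in> r `` {\<one>}" if "a \<in> r `` {\<one>}" "b \<in> r `` {\<one>}" for a b
      using that mult_cong [of \<one> a \<one> b] by simp
  qed
  show "x \<otimes> h \<otimes> inv x \<in> r `` {\<one>}" if x: "x \<in> carrier G" and h: "h \<in> r `` {\<one>}" for x h
  proof -
    have "(x \<otimes> \<one> \<otimes> inv x, x \<otimes> h \<otimes> inv x) \<in> r"
      using x h by (intro mult_cong related_refl) auto
    then show ?thesis
      using x by simp
  qed
qed

lemma r_coset_class_one: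
  assumes "x \<in> carrier G"
  shows "r `` {\<one>} #> x = r `` {x}"
proof (intro equalityI subsetI)
  fix y assume "y \<in> r `` {\<one>} #> x"
  then obtain h where "(\<one>, h) \<in> r" "y = h \<otimes> x"
    by (auto simp: r_coset_def)
  then show "y \<in> r `` {x}"
    using mult_cong [OF _ related_refl [OF assms], of \<one> h] assms by simp
next
  fix y assume "y \<in> r `` {x}"
  then have y: "(x, y) \<in> r" "y \<in> carrier G"
    using related_carrier by auto
  then have "(\<one>, y \<otimes> inv x) \<in> r"
    using related_iff_quotient [of x y] assms by simp
  moreover have "y = (y \<otimes> inv x) \<otimes> x"
    using y assms by (simp add: m_assoc)
  ultimately show "y \<in> r `` {\<one>} #> x"
    unfolding r_coset_def by blast
qed

text \<open>The cosets of the class of the identity are exactly the classes of \<open>r\<close>, and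
  both structures multiply sets elementwise. The group laws and the projection homomorphism are thus
  inherited from the factor group.\<close>

lemma class_group_eq_Mod: "class_group G r = G Mod (r `` {\<one>})"
  by (auto simp: class_group_def FactGroup_def RCOSETS_def quotient_def r_coset_class_one)

lemma group_class_group: "group (class_group G r)"
  by (simp add: class_group_eq_Mod normal.factorgroup_is_group normal_class_one)

lemma class_hom: "(\<lambda>x. r `` {x}) \<in> hom G (class_group G r)"
proof -
  have "(#>) (r `` {\<one>}) \<in> hom G (class_group G r)"
    unfolding class_group_eq_Mod by (rule normal.r_coset_hom_Mod [OF normal_class_one])
  then show ?thesis
    by (rule hom_restrict) (simp add: r_coset_class_one)
qed

lemma carrier_class_group: "carrier (class_group G r) = (\<lambda>x. r `` {x}) ` carrier G"
  by (auto simp: class_group_def quotient_def)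

lemma one_class_group: "\<one>\<^bsub>class_group G r\<^esub> = r `` {\<one>}"
  by (simp add: class_group_def)

lemma class_eq_iff:
  assumes "x \<in> carrier G" "y \<in> carrier G"
  shows "r `` {x} = r `` {y} \<longleftrightarrow> (x, y) \<in> r"
  using assms by (simp add: eq_equiv_class_iff [OF equiv])

end

text \<open>\<open>class_map\<close> takes a union over all representatives of a class. By
  \<open>resp\<close> each of them contributes the same class of \<open>s\<close>, so the union
  collapses to the one named by \<open>x\<close>.\<close>

lemma class_map_class:
  assumes "group_congruence G r" "group_congruence H s"
    and resp: "\<And>x y. (x, y) \<in> r \<Longrightarrow> (\<phi> x, \<phi> y) \<in> s" and x: "x \<in> carrier G"
  shows "class_map s \<phi> (r `` {x}) = s `` {\<phi> x}"
proof -
  interpret G: group_congruence G r by fact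
  interpret H: group_congruence H s by fact
  have "s `` {\<phi> y} = s `` {\<phi> x}" if "(x, y) \<in> r" for y
    using equiv_class_eq [OF H.equiv resp [OF that]] by simp
  moreover have "x \<in> r `` {x}"
    using G.related_refl x by simp
  ultimately show ?thesis
    unfolding class_map_def by blast
qed

lemma class_map_hom:
  assumes G: "group_congruence G r" and H: "group_congruence H s"
    and resp: "\<And>x y. (x, y) \<in> r \<Longrightarrow> (\<phi> x, \<phi> y) \<in> s" and \<phi>: "\<phi> \<in> hom G H"
  shows "class_map s \<phi> \<in> hom (class_group G r) (class_group H s)"
proof -
  interpret G: group_congruence G r by fact
  interpret H: group_congruence H s by fact
  note on_class = class_map_class [OF G H resp]
  show ?thesis
  proof (rule homI)
    fix C assume "C \<in> carrier (class_group G r)"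
    then obtain x where x: "x \<in> carrier G" "C = r `` {x}"
      by (auto simp: G.carrier_class_group)
    then show "class_map s \<phi> C \<in> carrier (class_group H s)"
      using hom_in_carrier [OF \<phi>] by (simp add: on_class H.carrier_class_group)
    fix D assume "D \<in> carrier (class_group G r)"
    then obtain y where y: "y \<in> carrier G" "D = r `` {y}"
      by (auto simp: G.carrier_class_group)
    show "class_map s \<phi> (C \<otimes>\<^bsub>class_group G r\<^esub> D)
            = class_map s \<phi> C \<otimes>\<^bsub>class_group H s\<^esub> class_map s \<phi> D"
      using x y hom_in_carrier [OF \<phi>]
      by (simp add: on_class hom_mult [OF G.class_hom, symmetric] hom_mult [OF H.class_hom, symmetric]
          hom_mult [OF \<phi>, symmetric])
  qed
qed

lemma group_congruence_DirProd:
  assumes "group_congruence G r" "group_congruence H s"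
  shows "group_congruence (G \<times>\<times> H) {((a, b), (a', b')). (a, a') \<in> r \<and> (b, b') \<in> s}"
proof -
  interpret G: group_congruence G r by fact
  interpret H: group_congruence H s by fact
  let ?t = "{((a, b), (a', b')). (a, a') \<in> r \<and> (b, b') \<in> s}"
  have "?t \<subseteq> carrier (G \<times>\<times> H) \<times> carrier (G \<times>\<times> H)"
    using G.related_carrier H.related_carrier by auto
  moreover have "refl_on (carrier (G \<times>\<times> H)) ?t"
    using G.related_refl H.related_refl by (auto simp: refl_on_def)
  moreover have "sym ?t"
    using G.equiv H.equiv by (auto simp: equiv_def sym_def)
  moreover have "trans ?t"
    unfolding trans_def using G.equiv H.equiv by (auto simp: equiv_def dest: transD)
  ultimately have "equiv (carrier (G \<times>\<times> H)) ?t"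
    by (simp add: equiv_def)
  then show ?thesis
    by (intro group_congruence.intro DirProd_group G.is_group H.is_group group_congruence_axioms.intro)
      (auto simp: G.mult_cong H.mult_cong)
qed

lemma subgroup_image_group:
  assumes "group G" "group H" "h \<in> hom G H"
  shows "subgroup (h ` carrier G) H"
  using assms by (intro group_hom.img_is_subgroup) (simp add: group_hom_def group_hom_axioms_def)

section \<open>Orientations along isotopies\<close>

lemma singular_relboundary_mono:
  assumes "singular_relboundary p X S c" "S \<subseteq> T"
  shows "singular_relboundary p X T c"
  using assms singular_chain_mono unfolding singular_relboundary by blast

text \<open>Write \<open>c\<close> as a boundary plus a chain \<open>e\<close> that avoids
  \<open>p\<close>. Only finitely many simplices occur in \<open>e\<close>, their images are compact
  and hence closed in the Hausdorff space, and the complement of their union serves as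
  \<open>U\<close>.\<close>

lemma singular_relboundary_near_point:
  assumes X: "Hausdorff_space X" and p: "p \<in> topspace X"
    and c: "singular_relboundary n X (topspace X - {p}) c"
  obtains U where "openin X U" "p \<in> U" "singular_relboundary n X (topspace X - U) c"
proof -
  obtain d e where d: "singular_chain (Suc n) X d" and c_eq: "chain_boundary (Suc n) d + e = c"
    and e: "singular_chain n X e"
    and e_avoids: "\<And>f. f \<in> Poly_Mapping.keys e \<Longrightarrow> f ` standard_simplex n \<subseteq> topspace X - {p}"
    using c unfolding singular_relboundary singular_chain_subtopology by blast
  define K where "K = (\<Union>f \<in> Poly_Mapping.keys e. f ` standard_simplex n)"
  have "compactin X (f ` standard_simplex n)" if "f \<in> Poly_Mapping.keys e" for f
  proof (rule image_compactin)
    show "continuous_map (subtopology (powertop_real UNIV) (standard_simplex n)) X f"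
      using e that by (auto simp: singular_chain_def singular_simplex_def)
  qed (simp add: compactin_subtopology compactin_standard_simplex)
  then have "closedin X K"
    unfolding K_def by (intro closedin_Union) (auto intro: compactin_imp_closedin [OF X])
  show thesis
  proof
    show "openin X (topspace X - K)"
      using \<open>closedin X K\<close> by blast
    show "p \<in> topspace X - K"
      using p e_avoids by (auto simp: K_def)
    have "K \<subseteq> topspace X"
      using \<open>closedin X K\<close> closedin_subset by blast
    then have "singular_chain n (subtopology X (topspace X - (topspace X - K))) e"
      using e by (auto simp: singular_chain_subtopology K_def)
    then show "singular_relboundary n X (topspace X - (topspace X - K)) c"
      using d c_eq unfolding singular_relboundary by blast
  qed
qed

text \<open>The identity acts trivially on chains, so enlarging the subspace keeps the representing
  cycle. Statements about restricted homology classes thereby become statements about one fixed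
  chain.\<close>

lemma hom_induced_id_relcycle:
  assumes c: "singular_relcycle n X S c" and "S \<subseteq> T"
  shows "hom_induced (int n) X S X T id (homologous_rel_set n X S c) = homologous_rel_set n X T c"
proof -
  have "chain_map n id c = c"
    using c by (auto simp: singular_relcycle intro: chain_map_id_gen)
  then show ?thesis
    using assms by (subst hom_induced_chain_map) auto
qed

text \<open>Chains have compact support.\<close>

lemma local_homology_eq_near_point:
  assumes X: "Hausdorff_space X" and N: "openin X N" "p \<in> N"
    and a: "a \<in> carrier (local_homology n X N)" and b: "b \<in> carrier (local_homology n X N)"
    and eq: "hom_induced (int n) X (topspace X - N) X (topspace X - {p}) id a =
             hom_induced (int n) X (topspace X - N) X (topspace X - {p}) id b"
  obtains U where "openin X U" "p \<in> U" "U \<subseteq> N"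
    "\<And>y. y \<in> U \<Longrightarrow> hom_induced (int n) X (topspace X - N) X (topspace X - {y}) id a =
                   hom_induced (int n) X (topspace X - N) X (topspace X - {y}) id b"
proof -
  obtain c d where c: "singular_relcycle n X (topspace X - N) c"
      "a = homologous_rel_set n X (topspace X - N) c"
    and d: "singular_relcycle n X (topspace X - N) d"
      "b = homologous_rel_set n X (topspace X - N) d"
    using a b by (auto simp: carrier_relative_homology_group)
  \<comment> \<open>Agreement of the two restrictions at \<open>y\<close> means that the single
    chain \<open>c - d\<close> is a relative boundary modulo the complement of \<open>y\<close>; in
    this form it spreads from \<open>p\<close> to nearby points.\<close>
  have at: "hom_induced (int n) X (topspace X - N) X (topspace X - {y}) id a =
             hom_induced (int n) X (topspace X - N) X (topspace X - {y}) id b \<longleftrightarrow>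
             singular_relboundary n X (topspace X - {y}) (c - d)" if "y \<in> N" for y
  proof -
    have "topspace X - N \<subseteq> topspace X - {y}"
      using that by blast
    then show ?thesis
      by (simp add: c d hom_induced_id_relcycle homologous_rel_set_eq) (simp add: homologous_rel_def)
  qed
  have "p \<in> topspace X"
    using N openin_subset by blast
  moreover have "singular_relboundary n X (topspace X - {p}) (c - d)"
    using at N eq by blast
  ultimately obtain U where U: "openin X U" "p \<in> U" "singular_relboundary n X (topspace X - U) (c - d)"
    by (rule singular_relboundary_near_point [OF X])
  show thesis
  proof
    show "openin X (U \<inter> N)" "p \<in> U \<inter> N" "U \<inter> N \<subseteq> N"
      using U N by auto
    show "hom_induced (int n) X (topspace X - N) X (topspace X - {y}) id a =
          hom_induced (int n) X (topspace X - N) X (topspace X - {y}) id b" if "y \<in> U \<inter> N" for y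
    proof -
      have "topspace X - U \<subseteq> topspace X - {y}"
        using that by blast
      then show ?thesis
        using at that singular_relboundary_mono U(3) by blast
    qed
  qed
qed

section \<open>Homeomorphisms and local homology\<close>

lemma homeomorphic_map_image_Diff:
  assumes "homeomorphic_map X X f" "S \<subseteq> topspace X"
  shows "f ` (topspace X - S) = topspace X - f ` S"
proof -
  have "f ` topspace X = topspace X" "inj_on f (topspace X)"
    using assms homeomorphic_imp_surjective_map homeomorphic_imp_injective_map by blast+
  then show ?thesis
    using assms(2) by (metis inj_on_image_set_diff Diff_subset subset_refl)
qed

lemma homeomorphic_map_locally_modelled_at:
  assumes f: "homeomorphic_map X Y f" and x: "locally_modelled_at E X x"
  shows "locally_modelled_at E Y (f x)"
proof -
  obtain U V where U: "openin X U" "x \<in> U" and V: "openin E V"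
    and UV: "subtopology X U homeomorphic_space subtopology E V"
    using x unfolding locally_modelled_at_def by blast
  have sub: "U \<subseteq> topspace X" "f ` U \<subseteq> topspace Y"
    using U f homeomorphic_imp_surjective_map openin_subset by blast+
  have "openin Y (f ` U)"
    using f U homeomorphic_map_openness_eq by blast
  moreover have "homeomorphic_map (subtopology X U) (subtopology Y (f ` U)) f"
    using f sub by (simp add: homeomorphic_map_subtopologies Int_absorb1)
  then have "subtopology Y (f ` U) homeomorphic_space subtopology E V"
    using UV homeomorphic_map_imp_homeomorphic_space homeomorphic_space_sym homeomorphic_space_trans
    by blast
  ultimately show ?thesis
    unfolding locally_modelled_at_def using U V by blast
qed

text \<open>The interior is defined by a local model, which a homeomorphism transports. Consequently
  the track of an interior point under an isotopy stays where the orientation is a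
  generator.\<close>

lemma homeomorphic_map_manifold_interior:
  assumes "homeomorphic_map X X f" "x \<in> manifold_interior n X"
  shows "f x \<in> manifold_interior n X"
  using assms homeomorphic_map_locally_modelled_at [OF assms(1)] homeomorphic_imp_surjective_map [OF assms(1)]
  by (auto simp: manifold_interior_def)

lemma orientation_carrier:
  assumes "orientation n X \<mu>" "x \<in> manifold_interior n X"
  shows "\<mu> x \<in> carrier (local_homology n X {x})"
  using assms by (auto simp: orientation_def)

lemma orientation_locally_induced:
  assumes or: "orientation n X \<mu>" and x: "x \<in> manifold_interior n X"
  obtains U \<alpha> where "openin X U" "x \<in> U" "\<alpha> \<in> carrier (local_homology n X U)"
    "\<And>y. y \<in> U \<Longrightarrow> hom_induced (int n) X (topspace X - U) X (topspace X - {y}) id \<alpha> = \<mu> y"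
  using bspec [OF conjunct2 [OF or [unfolded orientation_def]] x] that by (elim exE conjE) simp

text \<open>This is the source of the multipliers: the exponent exists because \<mu> x generates,
  but it is determined only modulo the order of \<mu> x.\<close>

lemma orientation_generator:
  assumes or: "orientation n X \<mu>" and x: "x \<in> manifold_interior n X"
    and a: "a \<in> carrier (local_homology n X {x})"
  obtains k :: int where "a = \<mu> x [^]\<^bsub>local_homology n X {x}\<^esub> k"
proof -
  interpret group "local_homology n X {x}" by simp
  have "a \<in> generate (local_homology n X {x}) {\<mu> x}"
    using or x a by (auto simp: orientation_def)
  then show thesis
    using that generate_pow [OF orientation_carrier [OF or x]] by auto
qed

lemma homeomorphic_map_local_homology_iso:
  assumes f: "homeomorphic_map X X f" and x: "x \<in> topspace X"
  shows "hom_induced (int n) X (topspace X - {x}) X (topspace X - {f x}) f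
           \<in> iso (local_homology n X {x}) (local_homology n X {f x})"
  using homeomorphic_map_image_Diff [OF f, of "{x}"] x
  by (intro homeomorphic_map_relative_homology_iso [OF f]) auto

section \<open>Transport of local orientations along an isotopy\<close>

lemma isotopy_from_id_stage:
  assumes "isotopy_from_id X H" "t \<in> {0..1}"
  shows "homeomorphic_map X X (\<lambda>x. H (t, x))"
  using assms by (auto simp: isotopy_from_id_def)

lemma isotopy_from_id_track:
  assumes H: "isotopy_from_id X H" and x: "x \<in> topspace X"
  shows "continuous_map (top_of_set {0..1}) X (\<lambda>t. H (t, x))"
proof -
  have "continuous_map (top_of_set {0..1}) (prod_topology (top_of_set {0..1}) X) (\<lambda>t. (t, x))"
    using x by (intro continuous_intros) auto
  then have "continuous_map (top_of_set {0..1}) X (H \<circ> (\<lambda>t. (t, x)))"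
    using H continuous_map_compose unfolding isotopy_from_id_def by blast
  then show ?thesis
    by (simp add: o_def)
qed

text \<open>A subinterval of an isotopy is a homotopy of maps of pairs.\<close>

lemma hom_induced_isotopy_stages_eq:
  assumes cont: "continuous_map (prod_topology (top_of_set {0..1}) X) X H"
    and s: "s \<in> {0..1::real}" and t: "t \<in> {0..1}"
    and maps: "\<And>u. u \<in> closed_segment s t \<Longrightarrow> (\<lambda>x. H (u, x)) \<in> S \<rightarrow> T"
  shows "hom_induced p X S X T (\<lambda>x. H (s, x)) = hom_induced p X S X T (\<lambda>x. H (t, x))"
proof (rule homology_homotopy_axiom)
  \<comment> \<open>Affine reparametrization of the times between \<open>s\<close> and
    \<open>t\<close>. Using \<open>closed_segment\<close> allows \<open>s\<close> and
    \<open>t\<close> to come in either order.\<close>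
  let ?k = "\<lambda>(u, x). H ((1 - u) * s + u * t, x)"
  have "continuous_map (prod_topology (top_of_set {0..1}) X) (prod_topology (top_of_set {0..1}) X)
          (\<lambda>z. ((1 - fst z) * s + fst z * t, snd z))"
  proof (rule continuous_map_pairedI)
    have "continuous_map (prod_topology (top_of_set {0..1}) X) euclideanreal fst"
      using continuous_map_fst continuous_map_in_subtopology by blast
    then have "continuous_map (prod_topology (top_of_set {0..1}) X) euclideanreal
                 (\<lambda>z. (1 - fst z) * s + fst z * t)"
      by (intro continuous_intros) auto
    moreover have "(1 - u) * s + u * t \<in> {0..1}" if "u \<in> {0..1}" for u
      using that s t by (auto intro: convex_bound_le)
    ultimately show "continuous_map (prod_topology (top_of_set {0..1}) X) (top_of_set {0..1})
                       (\<lambda>z. (1 - fst z) * s + fst z * t)"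
      by (auto simp: continuous_map_in_subtopology)
  qed (simp add: continuous_map_snd)
  then have "continuous_map (prod_topology (top_of_set {0..1}) X) X ?k"
    using continuous_map_compose [OF _ cont] by (simp add: o_def case_prod_unfold)
  moreover have "(1 - u) * s + u * t \<in> closed_segment s t" if "u \<in> {0..1}" for u
    using that by (auto simp: closed_segment_def)
  ultimately show "homotopic_with (\<lambda>h. h \<in> S \<rightarrow> T) X X (\<lambda>x. H (s, x)) (\<lambda>x. H (t, x))"
    unfolding homotopic_with_def using maps by (intro exI [of _ ?k]) auto
qed

text \<open>The image of the compact set \<open>C\<close> at time \<open>t\<close> is compact and
  can be separated from \<open>p\<close> by open sets \<open>A\<close> and \<open>B\<close>. The
  preimage of \<open>A\<close> contains \<open>{t}\<close> times \<open>C\<close>, and the tube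
  lemma widens \<open>t\<close> to a whole neighbourhood of times.\<close>

lemma isotopy_avoids_near_point:
  assumes X: "compact_space X" "Hausdorff_space X"
    and cont: "continuous_map (prod_topology (top_of_set {0..1}) X) X H"
    and C: "closedin X C" and t: "t \<in> {0..1::real}"
    and p: "p \<in> topspace X" "p \<notin> (\<lambda>x. H (t, x)) ` C"
  obtains e B where "e > 0" "openin X B" "p \<in> B"
    "\<And>s x. \<lbrakk>s \<in> {0..1}; dist t s < e; x \<in> C\<rbrakk> \<Longrightarrow> H (s, x) \<notin> B"
proof -
  let ?I = "top_of_set {0..1::real}"
  have C': "compactin X C"
    using X C closedin_compact_space by blast
  have "continuous_map X (prod_topology ?I X) (\<lambda>x. (t, x))"
    using t by (intro continuous_intros) auto
  then have "continuous_map X X (H \<circ> (\<lambda>x. (t, x)))"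
    using cont continuous_map_compose by blast
  then have "compactin X ((\<lambda>x. H (t, x)) ` C)"
    using image_compactin [OF C'] by (simp add: o_def)
  then obtain A B where AB: "openin X A" "openin X B" "(\<lambda>x. H (t, x)) ` C \<subseteq> A" "p \<in> B" "disjnt A B"
    using Hausdorff_space_compact_separation [OF X(2), of "(\<lambda>x. H (t, x)) ` C" "{p}"] p by auto
  have CX: "C \<subseteq> topspace X"
    using C closedin_subset by blast
  define P where "P = {z \<in> topspace (prod_topology ?I X). H z \<in> A}"
  have "openin (prod_topology ?I X) P"
    unfolding P_def using cont AB(1) by (rule openin_continuous_map_preimage)
  moreover have "{t} \<times> C \<subseteq> P"
    using t CX AB(3) by (auto simp: P_def)
  moreover have "t \<in> topspace ?I"
    using t by simp
  ultimately obtain T D where TD: "openin ?I T" "t \<in> T" "C \<subseteq> D" "T \<times> D \<subseteq> P"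
    using tube_lemma_right [OF _ C'] by metis
  then obtain e where e: "e > 0" "\<And>s. \<lbrakk>s \<in> {0..1}; dist s t < e\<rbrakk> \<Longrightarrow> s \<in> T"
    unfolding openin_euclidean_subtopology_iff by metis
  show thesis
  proof
    show "e > 0" "openin X B" "p \<in> B"
      using e(1) AB by blast+
    show "H (s, x) \<notin> B" if "s \<in> {0..1}" "dist t s < e" "x \<in> C" for s x
    proof -
      have "(s, x) \<in> T \<times> D"
        using that e TD(3) by (auto simp: dist_commute)
      then show ?thesis
        using TD(4) AB(5) by (auto simp: disjnt_iff P_def)
    qed
  qed
qed

text \<open>Near \<open>x\<close> the orientation comes from one class \<beta> over
  \<open>N\<close>, near \<open>H (t, x)\<close> from one class \<alpha> over \<open>U0\<close>. For
  a small \<open>U\<close> around \<open>H (t, x)\<close>, all stages close to \<open>t\<close> map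
  the complement of \<open>N\<close> into the complement of \<open>U\<close> and, being homotopic as
  maps of pairs, push \<beta> to the same class over \<open>U\<close>. This class agrees with the
  k-th power of the restriction of \<alpha> at one point, hence at all nearby points, in particular
  at \<open>H (s, x)\<close> for \<open>s\<close> close to \<open>t\<close>.\<close>

lemma isotopy_from_id_power_near:
  assumes X: "compact_space X" "Hausdorff_space X" and or: "orientation n X \<mu>"
    and H: "isotopy_from_id X H" and t: "t \<in> {0..1}" and x: "x \<in> manifold_interior n X"
    and eq: "hom_induced (int n) X (topspace X - {x}) X (topspace X - {H (t, x)}) (\<lambda>z. H (t, z)) (\<mu> x)
             = \<mu> (H (t, x)) [^]\<^bsub>local_homology n X {H (t, x)}\<^esub> (k::int)"
  obtains T where "openin (top_of_set {0..1}) T" "t \<in> T"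
    "\<And>s. s \<in> T \<Longrightarrow>
       hom_induced (int n) X (topspace X - {x}) X (topspace X - {H (s, x)}) (\<lambda>z. H (s, z)) (\<mu> x)
       = \<mu> (H (s, x)) [^]\<^bsub>local_homology n X {H (s, x)}\<^esub> k"
proof -
  let ?S = "topspace X"
  let ?\<rho> = "\<lambda>U V. hom_induced (int n) X (?S - U) X (?S - V) id"
  let ?h = "\<lambda>U V s. hom_induced (int n) X (?S - U) X (?S - V) (\<lambda>z. H (s, z))"
  have xS: "x \<in> ?S"
    using x by (simp add: manifold_interior_def)
  have cont: "continuous_map (prod_topology (top_of_set {0..1}) X) X H"
    using H by (simp add: isotopy_from_id_def)
  have homeo: "homeomorphic_map X X (\<lambda>x. H (s, x))" if "s \<in> {0..1}" for s
    using isotopy_from_id_stage [OF H that] .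
  have stage: "continuous_map X X (\<lambda>x. H (s, x))" if "s \<in> {0..1}" for s
    using homeo [OF that] homeomorphic_imp_continuous_map by blast
  have img: "H (s, z) \<in> ?S" if "s \<in> {0..1}" "z \<in> ?S" for s z
    using homeomorphic_imp_surjective_map [OF homeo [OF that(1)]] that(2) by auto
  have inj: "H (s, z) \<noteq> H (s, x)" if "s \<in> {0..1}" "z \<in> ?S" "z \<noteq> x" for s z
    using homeomorphic_imp_injective_map [OF homeo [OF that(1)]] that xS by (auto simp: inj_on_def)
  have power: "?\<rho> U {y} (a [^]\<^bsub>local_homology n X U\<^esub> k) = ?\<rho> U {y} a [^]\<^bsub>local_homology n X {y}\<^esub> k"
    if "a \<in> carrier (local_homology n X U)" for U y a
    using hom_int_pow [OF hom_induced_hom that] by simp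
  have restrict2: "?\<rho> U {y} (?\<rho> N U a) = ?\<rho> N {y} a" if "U \<subseteq> N" "y \<in> U" for U N y a
    using that by (subst hom_induced_compose') auto
  obtain N \<beta> where N: "openin X N" "x \<in> N" and \<beta>: "\<beta> \<in> carrier (local_homology n X N)"
    and \<beta>\<mu>: "\<And>y. y \<in> N \<Longrightarrow> ?\<rho> N {y} \<beta> = \<mu> y"
    by (rule orientation_locally_induced [OF or x]) (rule that)
  define p where "p = H (t, x)"
  have p: "p \<in> manifold_interior n X"
    unfolding p_def using homeomorphic_map_manifold_interior [OF homeo [OF t] x] .
  then have pS: "p \<in> ?S"
    by (simp add: manifold_interior_def)
  obtain U0 \<alpha> where U0: "openin X U0" "p \<in> U0" and \<alpha>: "\<alpha> \<in> carrier (local_homology n X U0)"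
    and \<alpha>\<mu>: "\<And>y. y \<in> U0 \<Longrightarrow> ?\<rho> U0 {y} \<alpha> = \<mu> y"
    by (rule orientation_locally_induced [OF or p]) (rule that)
  have "closedin X (?S - N)"
    using N(1) by (simp add: closedin_diff)
  moreover have "p \<notin> (\<lambda>z. H (t, z)) ` (?S - N)"
  proof
    assume "p \<in> (\<lambda>z. H (t, z)) ` (?S - N)"
    then obtain z where z: "p = H (t, z)" "z \<in> ?S - N"
      by (rule imageE)
    then have "z \<noteq> x"
      using N(2) by blast
    then show False
      using inj [OF t, of z] z by (simp add: p_def)
  qed
  ultimately obtain e B where e: "e > 0" and B: "openin X B" "p \<in> B"
    and avoid: "\<And>s z. \<lbrakk>s \<in> {0..1}; dist t s < e; z \<in> ?S - N\<rbrakk> \<Longrightarrow> H (s, z) \<notin> B"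
    using isotopy_avoids_near_point [OF X cont _ t pS] by metis
  define U where "U = U0 \<inter> B"
  have U: "openin X U" "p \<in> U" "U \<subseteq> U0" "U \<subseteq> B"
    using U0 B by (auto simp: U_def)
  \<comment> \<open>\<delta> is the orientation class of \<open>N\<close> pushed forward at time
    \<open>t\<close>, and \<gamma> is the k-th power of the orientation class near \<open>p\<close>.
    Both live over the same \<open>U\<close>, so they can be compared point by point.\<close>
  define \<delta> where "\<delta> = ?h N U t \<beta>"
  define \<gamma> where "\<gamma> = ?\<rho> U0 U \<alpha> [^]\<^bsub>local_homology n X U\<^esub> k"
  have into: "(\<lambda>z. H (s, z)) \<in> ?S - N \<rightarrow> ?S - U" if "s \<in> {0..1}" "dist t s < e" for s
    using avoid [OF that] img [OF that(1)] U(4) by blast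
  \<comment> \<open>As a map of pairs from X modulo the complement of \<open>N\<close> to X modulo
    the complement of \<open>H (s, x)\<close>, the stage at time \<open>s\<close> factors both
    through the complement of \<open>x\<close> and through the complement of \<open>U\<close>. The
    two factorizations give the two sides.\<close>
  have at: "?h {x} {H (s, x)} s (\<mu> x) = ?\<rho> U {H (s, x)} \<delta>"
    if s: "s \<in> {0..1}" "dist t s < e" and y: "H (s, x) \<in> U" for s
  proof -
    have "u \<in> {0..1}" "dist t u < e" if "u \<in> closed_segment t s" for u
      using that s t e by (auto simp: closed_segment_eq_real_ivl dist_real_def split: if_splits)
    then have \<delta>s: "\<delta> = ?h N U s \<beta>"
      unfolding \<delta>_def using hom_induced_isotopy_stages_eq [OF cont t s(1)] into by metis
    have "?h {x} {H (s, x)} s (\<mu> x) = ?h {x} {H (s, x)} s (?\<rho> N {x} \<beta>)"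
      using \<beta>\<mu> N by simp
    also have "\<dots> = ?h N {H (s, x)} s \<beta>"
      using stage [OF s(1)] img [OF s(1)] inj [OF s(1)] N by (subst hom_induced_compose') (auto simp: o_def)
    also have "\<dots> = ?\<rho> U {H (s, x)} (?h N U s \<beta>)"
      using stage [OF s(1)] into [OF s] y by (subst hom_induced_compose') (auto simp: o_def)
    finally show ?thesis
      by (simp add: \<delta>s)
  qed
  have group_U: "group (local_homology n X U)"
    by simp
  have \<gamma>: "\<gamma> \<in> carrier (local_homology n X U)"
    unfolding \<gamma>_def by (intro group.int_pow_closed [OF group_U] hom_induced_carrier)
  have \<gamma>\<mu>: "?\<rho> U {y} \<gamma> = \<mu> y [^]\<^bsub>local_homology n X {y}\<^esub> k" if "y \<in> U" for y
    unfolding \<gamma>_def using that U(3) \<alpha>\<mu>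
    by (simp add: power [OF hom_induced_carrier] restrict2 subset_iff)
  have "?\<rho> U {p} \<delta> = ?\<rho> U {p} \<gamma>"
    using at [OF t] e U(2) eq \<gamma>\<mu> [OF U(2)] by (simp add: p_def)
  moreover have "\<delta> \<in> carrier (local_homology n X U)"
    unfolding \<delta>_def by (rule hom_induced_carrier)
  ultimately obtain U' where U': "openin X U'" "p \<in> U'" "U' \<subseteq> U"
    and same: "\<And>y. y \<in> U' \<Longrightarrow> ?\<rho> U {y} \<delta> = ?\<rho> U {y} \<gamma>"
    using local_homology_eq_near_point [OF X(2) U(1,2) _ \<gamma>] by metis
  \<comment> \<open>The first set keeps the track of \<open>x\<close> where \<delta> and \<gamma>
    agree; the second keeps the time close enough to \<open>t\<close> for \<delta> to be the
    transported class.\<close>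
  define T where "T = {s \<in> {0..1}. H (s, x) \<in> U'} \<inter> ({0..1} \<inter> ball t e)"
  show thesis
  proof
    have "openin (top_of_set {0..1}) {s \<in> topspace (top_of_set {0..1}). H (s, x) \<in> U'}"
      by (rule openin_continuous_map_preimage [OF isotopy_from_id_track [OF H xS] U'(1)])
    then show "openin (top_of_set {0..1}) T"
      unfolding T_def by (intro openin_Int openin_open_Int) auto
    show "t \<in> T"
      using t U'(2) e by (simp add: T_def p_def)
    show "?h {x} {H (s, x)} s (\<mu> x) = \<mu> (H (s, x)) [^]\<^bsub>local_homology n X {H (s, x)}\<^esub> k"
      if "s \<in> T" for s
    proof -
      have s: "s \<in> {0..1}" "dist t s < e" "H (s, x) \<in> U'"
        using that by (auto simp: T_def)
      then show ?thesis
        using at same \<gamma>\<mu> U'(3) by (metis subsetD)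
    qed
  qed
qed

text \<open>The isomorphism need not send \<open>a\<close> to \<open>b\<close>, but
  \<open>h a\<close> is a power of \<open>b\<close>, and \<open>b\<close> is the image of a power of
  \<open>a\<close>. So each exponent that annihilates one generator annihilates the other.\<close>

lemma iso_cyclic_generator_order:
  assumes h: "h \<in> iso G K" and G: "group G" and K: "group K"
    and a: "a \<in> carrier G" and a_gen: "\<And>z. z \<in> carrier G \<Longrightarrow> \<exists>m::int. z = a [^]\<^bsub>G\<^esub> m"
    and b: "b \<in> carrier K" and b_gen: "\<And>z. z \<in> carrier K \<Longrightarrow> \<exists>m::int. z = b [^]\<^bsub>K\<^esub> m"
  shows "a [^]\<^bsub>G\<^esub> (l::int) = \<one>\<^bsub>G\<^esub> \<longleftrightarrow> b [^]\<^bsub>K\<^esub> l = \<one>\<^bsub>K\<^esub>"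
proof -
  interpret G: group G by fact
  interpret K: group K by fact
  interpret group_hom G K h
    using h by unfold_locales (auto simp: iso_def)
  have bij: "bij_betw h (carrier G) (carrier K)"
    using h by (simp add: iso_def)
  obtain m :: int where m: "h a = b [^]\<^bsub>K\<^esub> m"
    using b_gen [OF hom_closed [OF a]] by (rule exE)
  have "b \<in> h ` carrier G"
    using b by (simp add: bij_betw_imp_surj_on [OF bij])
  then obtain c where c: "b = h c" "c \<in> carrier G"
    by (rule imageE)
  obtain j :: int where j: "c = a [^]\<^bsub>G\<^esub> j"
    using a_gen [OF c(2)] by (rule exE)
  show ?thesis
  proof
    assume l: "a [^]\<^bsub>G\<^esub> l = \<one>\<^bsub>G\<^esub>"
    have "b [^]\<^bsub>K\<^esub> l = h (c [^]\<^bsub>G\<^esub> l)"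
      using c hom_int_pow by simp
    also have "c [^]\<^bsub>G\<^esub> l = (a [^]\<^bsub>G\<^esub> l) [^]\<^bsub>G\<^esub> j"
      using a by (simp add: j G.int_pow_pow mult.commute)
    finally show "b [^]\<^bsub>K\<^esub> l = \<one>\<^bsub>K\<^esub>"
      using l by simp
  next
    assume l: "b [^]\<^bsub>K\<^esub> l = \<one>\<^bsub>K\<^esub>"
    have "h (a [^]\<^bsub>G\<^esub> l) = (b [^]\<^bsub>K\<^esub> l) [^]\<^bsub>K\<^esub> m"
      using a b hom_int_pow by (simp add: m K.int_pow_pow mult.commute)
    then have "h (a [^]\<^bsub>G\<^esub> l) = h \<one>\<^bsub>G\<^esub>"
      using l by simp
    then show "a [^]\<^bsub>G\<^esub> l = \<one>\<^bsub>G\<^esub>"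
      using a by (intro inj_onD [OF bij_betw_imp_inj_on [OF bij]]) auto
  qed
qed

lemma (in group) int_pow_eq_iff_diff:
  assumes "a \<in> carrier G"
  shows "a [^] (k::int) = a [^] (l::int) \<longleftrightarrow> a [^] (k - l) = \<one>"
proof -
  have "a [^] k = a [^] (k - l) \<otimes> a [^] l"
    using assms by (simp add: int_pow_mult [symmetric])
  then show ?thesis
    using assms by (simp add: r_cancel_one)
qed

text \<open>Along the track of \<open>x\<close> the class transported from \<open>x\<close> is always a multiple of the local
  orientation, and each multiplier persists nearby; so the times with multiplier one form a
  clopen subset of the interval.\<close>

lemma isotopy_from_id_orientation_preserving:
  assumes X: "compact_oriented_manifold X" and H: "isotopy_from_id (topo X) H" and t: "t \<in> {0..1}"
  shows "orientation_preserving X (\<lambda>x. H (t, x))"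
  unfolding orientation_preserving_def
proof
  let ?n = "dimen X" and ?X = "topo X" and ?\<mu> = "orient X"
  fix x
  assume x: "x \<in> manifold_interior ?n ?X"
  have cpt: "compact_space ?X" "Hausdorff_space ?X" and or: "orientation ?n ?X ?\<mu>"
    using X by (auto simp: compact_oriented_manifold_def compact_manifold_def)
  have xS: "x \<in> points X"
    using x by (simp add: manifold_interior_def)
  let ?G = "\<lambda>y. local_homology ?n ?X {y}"
  let ?tr = "\<lambda>s. hom_induced (int ?n) ?X (points X - {x}) ?X (points X - {H (s, x)}) (\<lambda>z. H (s, z))"
  define Q where "Q = (\<lambda>(k::int) s. ?tr s (?\<mu> x) = ?\<mu> (H (s, x)) [^]\<^bsub>?G (H (s, x))\<^esub> k)"
  have near: "\<exists>T. openin (top_of_set {0..1}) T \<and> s \<in> T \<and> (\<forall>u \<in> T. Q k u)"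
    if s: "s \<in> {0..1}" "Q k s" for s k
    using isotopy_from_id_power_near [OF cpt or H s(1) x s(2) [unfolded Q_def]] unfolding Q_def by metis
  have int: "H (s, x) \<in> manifold_interior ?n ?X" if "s \<in> {0..1}" for s
    using homeomorphic_map_manifold_interior [OF isotopy_from_id_stage [OF H that] x] .
  have ex: "\<exists>k. Q k s" if "s \<in> {0..1}" for s
    unfolding Q_def by (rule orientation_generator [OF or int [OF that] hom_induced_carrier]) blast
  have grp: "group (?G y)" for y
    by simp
  have order: "?\<mu> x [^]\<^bsub>?G x\<^esub> l = \<one>\<^bsub>?G x\<^esub> \<longleftrightarrow> ?\<mu> (H (s, x)) [^]\<^bsub>?G (H (s, x))\<^esub> l = \<one>\<^bsub>?G (H (s, x))\<^esub>"
    if "s \<in> {0..1}" for s and l :: int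
    by (rule iso_cyclic_generator_order
          [OF homeomorphic_map_local_homology_iso [OF isotopy_from_id_stage [OF H that] xS] grp grp])
      (use orientation_carrier [OF or] orientation_generator [OF or] x int [OF that] in metis)+
  have power_eq: "?\<mu> y [^]\<^bsub>?G y\<^esub> k = ?\<mu> y [^]\<^bsub>?G y\<^esub> (1::int) \<longleftrightarrow> ?\<mu> y [^]\<^bsub>?G y\<^esub> (k - 1) = \<one>\<^bsub>?G y\<^esub>"
    if "y \<in> manifold_interior ?n ?X" for y and k :: int
    by (rule group.int_pow_eq_iff_diff [OF grp orientation_carrier [OF or that]])
  \<comment> \<open>Multipliers are not unique: having both \<open>k\<close> and 1 at time
    \<open>u\<close> says that \<open>k - 1\<close> annihilates the generator there. By
    \<open>order\<close>, applied through the point \<open>x\<close>, it also annihilates the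
    generator at time \<open>s\<close>, where \<open>k\<close> may then be replaced by 1.\<close>
  have transfer: "Q 1 s" if s: "s \<in> {0..1}" and u: "u \<in> {0..1}" and Q: "Q k s" "Q k u" "Q 1 u" for s u k
  proof -
    have "?\<mu> (H (u, x)) [^]\<^bsub>?G (H (u, x))\<^esub> (k - 1) = \<one>\<^bsub>?G (H (u, x))\<^esub>"
      using Q power_eq [OF int [OF u]] by (simp add: Q_def)
    then have "?\<mu> (H (s, x)) [^]\<^bsub>?G (H (s, x))\<^esub> (k - 1) = \<one>\<^bsub>?G (H (s, x))\<^esub>"
      using order s u by metis
    then show ?thesis
      using Q(1) power_eq [OF int [OF s]] by (simp add: Q_def)
  qed
  define T where "T = {s \<in> {0..1}. Q 1 s}"
  have "openin (top_of_set {0..1}) T"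
  proof (subst openin_subopen, intro ballI)
    fix s assume "s \<in> T"
    then have "s \<in> {0..1}" "Q 1 s"
      by (auto simp: T_def)
    from near [OF this] obtain I where I: "openin (top_of_set {0..1}) I" "s \<in> I" "\<forall>u \<in> I. Q 1 u"
      by (elim exE conjE)
    then have "I \<subseteq> T"
      using openin_subset [OF I(1)] by (auto simp: T_def)
    with I show "\<exists>I. openin (top_of_set {0..1}) I \<and> s \<in> I \<and> I \<subseteq> T"
      by (intro exI [of _ I]) simp
  qed
  moreover have "openin (top_of_set {0..1}) ({0..1} - T)"
  proof (subst openin_subopen, intro ballI)
    fix s assume "s \<in> {0..1} - T"
    then have s: "s \<in> {0..1}" "\<not> Q 1 s"
      by (auto simp: T_def)
    obtain k where k: "Q k s"
      using ex [OF s(1)] by (rule exE)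
    from near [OF s(1) k] obtain I
      where I: "openin (top_of_set {0..1}) I" "s \<in> I" "\<forall>u \<in> I. Q k u"
      by (elim exE conjE)
    \<comment> \<open>Some multiplier \<open>k\<close> of \<open>s\<close> is valid on all of
      \<open>I\<close>. If 1 were a multiplier at any time in \<open>I\<close>, then
      \<open>transfer\<close> would make it one at \<open>s\<close> as well.\<close>
    have "I \<subseteq> {0..1} - T"
      using transfer [OF s(1) _ k] s(2) I(3) openin_subset [OF I(1)] by (auto simp: T_def)
    with I show "\<exists>I. openin (top_of_set {0..1}) I \<and> s \<in> I \<and> I \<subseteq> {0..1} - T"
      by (intro exI [of _ I]) simp
  qed
  then have "closedin (top_of_set {0..1}) T"
    by (auto simp: closedin_def T_def)
  moreover have "0 \<in> T"
  proof -
    have H0: "H (0, z) = z" if "z \<in> points X" for z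
      using H that by (simp add: isotopy_from_id_def)
    have "continuous_map ?X ?X (\<lambda>z. H (0, z))"
      by (intro homeomorphic_imp_continuous_map isotopy_from_id_stage [OF H]) simp
    then have "?tr 0 (?\<mu> x) = ?\<mu> (H (0, x))"
      using hom_induced_id_gen [OF _ _ orientation_carrier [OF or x]] H0 xS by simp
    then show ?thesis
      using group.int_pow_1 [OF grp orientation_carrier [OF or int [of 0]]] by (simp add: T_def Q_def)
  qed
  ultimately have "T = {0..1}"
    using connected_clopen [of "{0..1::real}"] by auto
  with t have "t \<in> T"
    by simp
  then have "Q 1 t"
    by (simp add: T_def)
  then show "?tr t (?\<mu> x) = ?\<mu> (H (t, x))"
    using group.int_pow_1 [OF grp orientation_carrier [OF or int [OF t]]] by (simp add: Q_def)
qed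

section \<open>Groups of automorphisms\<close>

text \<open>Restricting a map to the points of the manifold changes its values elsewhere; this makes
  such a change harmless for the orientation condition.\<close>

lemma orientation_preserving_cong:
  assumes "\<And>x. x \<in> points X \<Longrightarrow> f x = g x"
  shows "orientation_preserving X f \<longleftrightarrow> orientation_preserving X g"
proof -
  have "hom_induced p (topo X) S (topo X) T f = hom_induced p (topo X) S (topo X) T g" for p S T
    using assms by (rule hom_induced_eq)
  then show ?thesis
    using assms by (simp add: orientation_preserving_def manifold_interior_def)
qed

lemma homeomorphic_map_punctured:
  assumes "homeomorphic_map X X f" "x \<in> topspace X"
  shows "f \<in> topspace X - {x} \<rightarrow> topspace X - {f x}"
  using homeomorphic_map_image_Diff [OF assms(1), of "{x}"] assms(2) by auto

lemma orientation_preserving_compose: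
  assumes f: "homeomorphic_map (topo X) (topo X) f" "orientation_preserving X f"
    and g: "homeomorphic_map (topo X) (topo X) g" "orientation_preserving X g"
  shows "orientation_preserving X (f \<circ> g)"
  unfolding orientation_preserving_def
proof
  fix x assume x: "x \<in> manifold_interior (dimen X) (topo X)"
  then have gx: "g x \<in> manifold_interior (dimen X) (topo X)"
    by (rule homeomorphic_map_manifold_interior [OF g(1)])
  have "x \<in> points X" "g x \<in> points X"
    using x gx by (simp_all add: manifold_interior_def)
  then have "hom_induced (int (dimen X)) (topo X) (points X - {x}) (topo X) (points X - {f (g x)}) (f \<circ> g) c
      = hom_induced (int (dimen X)) (topo X) (points X - {g x}) (topo X) (points X - {f (g x)}) f
         (hom_induced (int (dimen X)) (topo X) (points X - {x}) (topo X) (points X - {g x}) g c)" for c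
    using f(1) g(1)
    by (intro hom_induced_compose' [symmetric] homeomorphic_imp_continuous_map homeomorphic_map_punctured)
  then show "hom_induced (int (dimen X)) (topo X) (points X - {x}) (topo X) (points X - {(f \<circ> g) x}) (f \<circ> g)
      (orient X x) = orient X ((f \<circ> g) x)"
    using f(2) g(2) x gx by (simp add: orientation_preserving_def)
qed

text \<open>Put \<open>x = g y\<close>. Applying the map induced by \<open>g\<close> to the equation
  for \<open>f\<close> at \<open>x\<close> gives the equation for \<open>g\<close> at
  \<open>y\<close>, because \<open>g \<circ> f\<close> fixes all points and so acts as the identity
  on the local homology at \<open>x\<close>.\<close>

lemma orientation_preserving_inverse:
  assumes or: "orientation (dimen X) (topo X) (orient X)"
    and fg: "homeomorphic_maps (topo X) (topo X) f g" and f: "orientation_preserving X f"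
  shows "orientation_preserving X g"
  unfolding orientation_preserving_def
proof
  fix y assume y: "y \<in> manifold_interior (dimen X) (topo X)"
  have homeo: "homeomorphic_map (topo X) (topo X) f" "homeomorphic_map (topo X) (topo X) g"
    and inv: "\<And>x. x \<in> points X \<Longrightarrow> g (f x) = x" "\<And>x. x \<in> points X \<Longrightarrow> f (g x) = x"
    using fg by (auto simp: homeomorphic_maps_map)
  define x where "x = g y"
  have x: "x \<in> manifold_interior (dimen X) (topo X)"
    unfolding x_def by (rule homeomorphic_map_manifold_interior [OF homeo(2) y])
  have fx: "f x = y" and pts: "x \<in> points X" "y \<in> points X"
    using x y inv by (simp_all add: x_def manifold_interior_def)
  have gf: "g \<circ> f \<in> points X - {x} \<rightarrow> points X - {x}" "continuous_map (topo X) (topo X) (g \<circ> f)"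
    using homeo inv by (auto intro: continuous_map_compose homeomorphic_imp_continuous_map)
  have "hom_induced (int (dimen X)) (topo X) (points X - {y}) (topo X) (points X - {x}) g (orient X y)
      = hom_induced (int (dimen X)) (topo X) (points X - {y}) (topo X) (points X - {x}) g
         (hom_induced (int (dimen X)) (topo X) (points X - {x}) (topo X) (points X - {y}) f (orient X x))"
    using bspec [OF f [unfolded orientation_preserving_def] x] by (simp add: fx)
  also have "\<dots> = hom_induced (int (dimen X)) (topo X) (points X - {x}) (topo X) (points X - {x}) (g \<circ> f) (orient X x)"
    using homeo homeomorphic_map_punctured [OF homeo(1) pts(1), unfolded fx]
      homeomorphic_map_punctured [OF homeo(2) pts(2), folded x_def]
    by (intro hom_induced_compose' homeomorphic_imp_continuous_map)
  also have "\<dots> = orient X x"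
    using gf inv by (intro hom_induced_id_gen orientation_carrier [OF or x]) auto
  finally show "hom_induced (int (dimen X)) (topo X) (points X - {y}) (topo X) (points X - {g y}) g
      (orient X y) = orient X (g y)"
    by (simp add: x_def)
qed

section \<open>Automorphism groups as subgroups of groups of bijections\<close>

lemma subgroup_BijGroupI:
  assumes "A \<subseteq> Bij S" "(\<lambda>x\<in>S. x) \<in> A"
    and "\<And>f g. \<lbrakk>f \<in> A; g \<in> A\<rbrakk> \<Longrightarrow> compose S f g \<in> A"
    and "\<And>f. f \<in> A \<Longrightarrow> restrict (inv_into S f) S \<in> A"
  shows "subgroup A (BijGroup S)"
proof (rule group.subgroupI [OF group_BijGroup])
  show "A \<subseteq> carrier (BijGroup S)" "A \<noteq> {}"
    using assms by (auto simp: BijGroup_def)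
  show "inv\<^bsub>BijGroup S\<^esub> f \<in> A" if "f \<in> A" for f
    using that assms by (simp add: inv_BijGroup subset_iff)
  show "f \<otimes>\<^bsub>BijGroup S\<^esub> g \<in> A" if "f \<in> A" "g \<in> A" for f g
    using that assms by (simp add: BijGroup_def subset_iff)
qed

lemma automorphismsD:
  assumes "f \<in> automorphisms X"
  shows "f \<in> Bij (points X)" "homeomorphic_map (topo X) (topo X) f"
    "continuous_map (topo X) (topo X) f" "orientation_preserving X f"
proof -
  show homeo: "homeomorphic_map (topo X) (topo X) f" and "orientation_preserving X f"
    using assms by (simp_all add: automorphisms_def)
  show "continuous_map (topo X) (topo X) f"
    by (rule homeomorphic_imp_continuous_map [OF homeo])
  show "f \<in> Bij (points X)"
    using assms homeomorphic_imp_surjective_map [OF homeo] homeomorphic_imp_injective_map [OF homeo]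
    by (simp add: automorphisms_def Bij_def bij_betw_def)
qed

lemma restrict_automorphismI:
  assumes "homeomorphic_map (topo X) (topo X) f" "orientation_preserving X f"
  shows "restrict f (points X) \<in> automorphisms X"
  using assms homeomorphic_map_eq [OF assms(1), of "restrict f (points X)"]
    orientation_preserving_cong [of X f "restrict f (points X)"]
  by (simp add: automorphisms_def)

lemma orientation_preserving_ident:
  assumes "orientation (dimen X) (topo X) (orient X)"
  shows "orientation_preserving X (\<lambda>x. x)"
  unfolding orientation_preserving_def
  by (intro ballI hom_induced_id_gen orientation_carrier [OF assms]) auto

text \<open>Inverses in \<open>BijGroup\<close> are given by \<open>inv_into\<close>, while a
  homeomorphism only provides some continuous inverse. The two agree on the space, which transfers
  continuity to \<open>inv_into\<close>.\<close>

lemma Bij_homeomorphic_maps: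
  assumes "f \<in> Bij (topspace X)" "homeomorphic_map X X f"
  shows "homeomorphic_maps X X f (inv_into (topspace X) f)"
proof -
  obtain g where g: "homeomorphic_maps X X f g"
    using assms(2) by (auto simp: homeomorphic_map_maps)
  have "g y = inv_into (topspace X) f y" if "y \<in> topspace X" for y
    using g that assms(1)
    by (auto simp: homeomorphic_maps_def continuous_map_def Bij_def bij_betw_def intro!: inv_into_f_eq [symmetric])
  then show ?thesis
    using g by (auto intro: homeomorphic_maps_eq)
qed

lemma subgroup_automorphisms:
  assumes or: "orientation (dimen X) (topo X) (orient X)"
  shows "subgroup (automorphisms X) (BijGroup (points X))"
proof (rule subgroup_BijGroupI)
  show "automorphisms X \<subseteq> Bij (points X)"
    using automorphismsD by auto
  show "(\<lambda>x\<in>points X. x) \<in> automorphisms X"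
    using homeomorphic_map_id [of "topo X" "topo X"]
    by (intro restrict_automorphismI orientation_preserving_ident [OF or]) (simp add: id_def)
  show "compose (points X) f g \<in> automorphisms X" if "f \<in> automorphisms X" "g \<in> automorphisms X" for f g
  proof -
    have "restrict (f \<circ> g) (points X) \<in> automorphisms X"
      using automorphismsD [OF that(1)] automorphismsD [OF that(2)]
      by (intro restrict_automorphismI homeomorphic_map_compose orientation_preserving_compose)
    then show ?thesis
      by (simp add: compose_def o_def)
  qed
  show "restrict (inv_into (points X) f) (points X) \<in> automorphisms X" if f: "f \<in> automorphisms X" for f
  proof (rule restrict_automorphismI)
    have "homeomorphic_maps (topo X) (topo X) f (inv_into (points X) f)"
      using Bij_homeomorphic_maps automorphismsD [OF f] by blast
    then show "homeomorphic_map (topo X) (topo X) (inv_into (points X) f)"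
      "orientation_preserving X (inv_into (points X) f)"
      using orientation_preserving_inverse [OF or _ automorphismsD(4) [OF f]]
      by (auto simp: homeomorphic_maps_map)
  qed
qed

lemma subgroup_BijGroupD:
  assumes "subgroup A (BijGroup S)"
  shows "A \<subseteq> Bij S" "(\<lambda>x\<in>S. x) \<in> A"
    "\<And>f g. \<lbrakk>f \<in> A; g \<in> A\<rbrakk> \<Longrightarrow> compose S f g \<in> A"
    "\<And>f. f \<in> A \<Longrightarrow> restrict (inv_into S f) S \<in> A"
proof -
  show A: "A \<subseteq> Bij S"
    using subgroup.subset [OF assms] by (simp add: BijGroup_def)
  show "(\<lambda>x\<in>S. x) \<in> A"
    using subgroup.one_closed [OF assms] by (simp add: BijGroup_def)
  show "compose S f g \<in> A" if "f \<in> A" "g \<in> A" for f g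
    using subgroup.m_closed [OF assms that] A that by (simp add: BijGroup_def subset_iff)
  show "restrict (inv_into S f) S \<in> A" if "f \<in> A" for f
    using subgroup.m_inv_closed [OF assms that] A that by (simp add: inv_BijGroup subset_iff)
qed

lemma restrict_compose:
  assumes "T \<subseteq> S" "g ` T \<subseteq> T"
  shows "restrict (compose S f g) T = compose T (restrict f T) (restrict g T)"
  using assms by (auto simp: compose_def fun_eq_iff)

text \<open>Since \<open>f\<close> maps \<open>T\<close> onto itself and is injective on
  \<open>S\<close>, the unique preimage in \<open>S\<close> of a point of \<open>T\<close> already
  lies in \<open>T\<close>.\<close>

lemma restrict_inv_into:
  assumes "inj_on f S" "T \<subseteq> S" "f ` T = T"
  shows "restrict (restrict (inv_into S f) S) T = restrict (inv_into T (restrict f T)) T"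
proof (rule restrict_ext [THEN trans [rotated]])
  show "restrict (restrict (inv_into S f) S) T = restrict (inv_into S f) T"
    using assms(2) by (auto simp: fun_eq_iff)
  fix y assume "y \<in> T"
  then obtain x where x: "x \<in> T" "y = f x"
    using assms(3) by blast
  have "inv_into S f y = x"
    using x assms by (auto intro: inv_into_f_eq)
  moreover have "inv_into T (restrict f T) y = x"
    using x assms by (intro inv_into_f_eq) (auto simp: inj_on_def)
  ultimately show "inv_into S f y = inv_into T (restrict f T) y"
    by simp
qed

lemma subgroup_pair_automorphisms:
  assumes M: "orientation (dimen M) (topo M) (orient M)" and W: "orientation (dimen W) (topo W) (orient W)"
    and WM: "points W \<subseteq> points M"
  shows "subgroup (pair_automorphisms M W) (BijGroup (points M))"
proof (rule subgroup_BijGroupI)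
  note autM = subgroup_BijGroupD [OF subgroup_automorphisms [OF M]]
  note autW = subgroup_BijGroupD [OF subgroup_automorphisms [OF W]]
  show "pair_automorphisms M W \<subseteq> Bij (points M)"
    using autM(1) by (auto simp: pair_automorphisms_def)
  show "(\<lambda>x\<in>points M. x) \<in> pair_automorphisms M W"
  proof -
    have "restrict (\<lambda>x\<in>points M. x) (points W) = (\<lambda>x\<in>points W. x)"
      using WM by (auto simp: fun_eq_iff)
    then show ?thesis
      using autM(2) autW(2) WM by (auto simp: pair_automorphisms_def)
  qed
  fix f assume f: "f \<in> pair_automorphisms M W"
  then have fM: "f \<in> automorphisms M" "f ` points W = points W" "restrict f (points W) \<in> automorphisms W"
    by (auto simp: pair_automorphisms_def)
  show "compose (points M) f g \<in> pair_automorphisms M W" if g: "g \<in> pair_automorphisms M W" for g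
  proof -
    have gM: "g \<in> automorphisms M" "g ` points W = points W" "restrict g (points W) \<in> automorphisms W"
      using g by (auto simp: pair_automorphisms_def)
    have "compose (points M) f g ` points W = f ` g ` points W"
      using WM by (auto simp: compose_def image_iff)
    then show ?thesis
      using fM gM autM(3) autW(3) restrict_compose [OF WM, of g f] by (simp add: pair_automorphisms_def)
  qed
  have inj: "inj_on f (points M)"
    using autM(1) fM(1) by (auto simp: Bij_def bij_betw_def)
  have "inv_into (points M) f ` points W = inv_into (points M) f ` f ` points W"
    using fM(2) by simp
  also have "\<dots> = points W"
    using inj WM by (rule inv_into_image_cancel)
  finally have "inv_into (points M) f ` points W = points W" .
  moreover have "restrict (inv_into (points M) f) (points M) ` points W = inv_into (points M) f ` points W"
    using WM by (intro image_cong) auto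
  ultimately show "restrict (inv_into (points M) f) (points M) \<in> pair_automorphisms M W"
    using fM autM(4) autW(4) restrict_inv_into [OF inj WM fM(2)] by (simp add: pair_automorphisms_def)
qed

lemma subgroup_rel_automorphisms:
  assumes pair: "subgroup (pair_automorphisms M W) (BijGroup (points M))" and VM: "points V \<subseteq> points M"
  shows "subgroup (rel_automorphisms M W V) (BijGroup (points M))"
proof (rule subgroup_BijGroupI)
  note pair' = subgroup_BijGroupD [OF pair]
  show "rel_automorphisms M W V \<subseteq> Bij (points M)" "(\<lambda>x\<in>points M. x) \<in> rel_automorphisms M W V"
    using pair'(1,2) VM by (auto simp: rel_automorphisms_def)
  show "compose (points M) f g \<in> rel_automorphisms M W V"
    if "f \<in> rel_automorphisms M W V" "g \<in> rel_automorphisms M W V" for f g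
    using that pair'(3) VM by (auto simp: rel_automorphisms_def compose_def)
  show "restrict (inv_into (points M) f) (points M) \<in> rel_automorphisms M W V"
    if f: "f \<in> rel_automorphisms M W V" for f
  proof -
    have "inj_on f (points M)"
      using f pair'(1) by (auto simp: rel_automorphisms_def Bij_def bij_betw_def)
    then have "inv_into (points M) f x = x" if "x \<in> points V" for x
      using f that VM by (intro inv_into_f_eq) (auto simp: rel_automorphisms_def)
    then show ?thesis
      using f pair'(4) VM by (auto simp: rel_automorphisms_def)
  qed
qed

section \<open>Isotopy as a congruence on automorphism groups\<close>

lemma homotopic_with_restrict:
  assumes h: "homotopic_with P X Y f g" and TX: "T \<subseteq> topspace X"
    and Q: "\<And>h. P h \<Longrightarrow> Q (restrict h T)" and U: "\<And>h. P h \<Longrightarrow> h ` T \<subseteq> U"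
  shows "homotopic_with Q (subtopology X T) (subtopology Y U) (restrict f T) (restrict g T)"
proof -
  let ?I = "top_of_set {0..1::real}"
  obtain k where k: "continuous_map (prod_topology ?I X) Y k" "\<forall>x. k (0, x) = f x" "\<forall>x. k (1, x) = g x"
    and P: "\<And>t. t \<in> {0..1} \<Longrightarrow> P (\<lambda>x. k (t, x))"
    using h unfolding homotopic_with_def by (elim exE conjE) simp
  \<comment> \<open>The cut-off leaves the homotopy unchanged over \<open>T\<close>, so continuity
    is unaffected. It makes every stage extensional and gives the right end maps also outside
    \<open>T\<close>, where \<open>homotopic_with\<close> prescribes them too.\<close>
  let ?k = "\<lambda>(t, x). restrict (\<lambda>x. k (t, x)) T x"
  have "continuous_map (subtopology (prod_topology ?I X) ({0..1} \<times> T)) Y k"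
    by (rule continuous_map_from_subtopology [OF k(1)])
  moreover have "subtopology (prod_topology ?I X) ({0..1} \<times> T) = prod_topology ?I (subtopology X T)"
    by (simp add: prod_topology_subtopology subtopology_subtopology)
  ultimately have "continuous_map (prod_topology ?I (subtopology X T)) Y ?k"
    by (auto intro: continuous_map_eq)
  moreover have "k (t, x) \<in> U" if "t \<in> {0..1}" "x \<in> T" for t x
    using U [OF P [OF that(1)]] that(2) by blast
  ultimately have "continuous_map (prod_topology ?I (subtopology X T)) (subtopology Y U) ?k"
    by (auto simp: continuous_map_in_subtopology)
  moreover have "Q (\<lambda>x. ?k (t, x))" if "t \<in> {0..1}" for t
    using Q [OF P [OF that]] by (simp add: restrict_def)
  ultimately show ?thesis
    unfolding homotopic_with_def using k(2,3) by (intro exI [of _ ?k]) (auto simp: fun_eq_iff)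
qed

lemma carrier_automorphism_group [simp]: "carrier (automorphism_group X A) = A"
  by (simp add: automorphism_group_def)

lemma one_automorphism_group [simp]: "\<one>\<^bsub>automorphism_group X A\<^esub> = (\<lambda>x\<in>points X. x)"
  by (simp add: automorphism_group_def BijGroup_def)

lemma mult_automorphism_group:
  assumes "A \<subseteq> Bij (points X)" "f \<in> A" "g \<in> A"
  shows "f \<otimes>\<^bsub>automorphism_group X A\<^esub> g = compose (points X) f g"
  using assms by (simp add: automorphism_group_def BijGroup_def subset_iff)

lemma isotopy_rel_congruence:
  assumes A: "subgroup A (BijGroup (points X))" and aut: "A \<subseteq> automorphisms X"
  shows "group_congruence (automorphism_group X A) (isotopy_rel X A)"
proof (intro group_congruence.intro group_congruence_axioms.intro)
  note A' = subgroup_BijGroupD [OF A]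
  have cont: "continuous_map (topo X) (topo X) f" if "f \<in> A" for f
    using aut that automorphismsD(3) by blast
  show "group (automorphism_group X A)"
    unfolding automorphism_group_def by (rule subgroup.subgroup_is_group [OF A group_BijGroup])
  show "equiv (carrier (automorphism_group X A)) (isotopy_rel X A)"
  proof (rule equivI)
    show "isotopy_rel X A \<subseteq> carrier (automorphism_group X A) \<times> carrier (automorphism_group X A)"
      by (auto simp: isotopy_rel_def)
    show "refl_on (carrier (automorphism_group X A)) (isotopy_rel X A)"
      using cont by (auto simp: isotopy_rel_def refl_on_def)
    show "sym (isotopy_rel X A)"
      by (auto simp: isotopy_rel_def sym_def intro: homotopic_with_symD)
    show "trans (isotopy_rel X A)"
      by (auto simp: isotopy_rel_def trans_def intro: homotopic_with_trans)
  qed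
  fix f f' g g'
  assume "(f, f') \<in> isotopy_rel X A" "(g, g') \<in> isotopy_rel X A"
  then have mem: "f \<in> A" "f' \<in> A" "g \<in> A" "g' \<in> A"
    and f: "homotopic_with (\<lambda>h. h \<in> A) (topo X) (topo X) f f'"
    and g: "homotopic_with (\<lambda>h. h \<in> A) (topo X) (topo X) g g'"
    by (auto simp: isotopy_rel_def)
  \<comment> \<open>A plain composite \<open>a \<circ> b\<close> need not be extensional and so may
    fall outside \<open>A\<close>. The homotopies therefore run through maps whose restriction lies
    in \<open>A\<close>; the second conjunct is what allows cutting all stages down to the points
    afterwards.\<close>
  let ?P = "\<lambda>h. restrict h (points X) \<in> A \<and> h \<in> points X \<rightarrow> points X"
  have comp: "?P (a \<circ> b)" if "a \<in> A" "b \<in> A" for a b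
  proof -
    have "a \<in> points X \<rightarrow> points X" "b \<in> points X \<rightarrow> points X"
      using that A'(1) by (simp_all add: Bij_imp_funcset subset_iff)
    then show ?thesis
      using A'(3) [OF that] by (auto simp: compose_def o_def)
  qed
  have "homotopic_with ?P (topo X) (topo X) (f \<circ> g) (f' \<circ> g)"
    by (rule homotopic_with_compose_continuous_map_right [OF f cont [OF mem(3)]]) (rule comp [OF _ mem(3)])
  moreover have "homotopic_with ?P (topo X) (topo X) (f' \<circ> g) (f' \<circ> g')"
    by (rule homotopic_with_compose_continuous_map_left [OF g cont [OF mem(2)]]) (rule comp [OF mem(2)])
  ultimately have "homotopic_with ?P (topo X) (topo X) (f \<circ> g) (f' \<circ> g')"
    by (rule homotopic_with_trans)
  then have "homotopic_with (\<lambda>h. h \<in> A) (subtopology (topo X) (points X)) (subtopology (topo X) (points X))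
      (restrict (f \<circ> g) (points X)) (restrict (f' \<circ> g') (points X))"
    by (rule homotopic_with_restrict) auto
  then have "(compose (points X) f g, compose (points X) f' g') \<in> isotopy_rel X A"
    using A'(3) mem by (simp add: isotopy_rel_def compose_def o_def)
  then show "(f \<otimes>\<^bsub>automorphism_group X A\<^esub> g, f' \<otimes>\<^bsub>automorphism_group X A\<^esub> g') \<in> isotopy_rel X A"
    using A'(1) mem by (simp add: mult_automorphism_group)
qed

lemma restrict_isotopy_rel:
  assumes fg: "(f, g) \<in> isotopy_rel X A" and YX: "points Y \<subseteq> points X"
    and topo: "topo Y = subtopology (topo X) (points Y)"
    and A: "\<And>h. h \<in> A \<Longrightarrow> h ` points Y = points Y \<and> restrict h (points Y) \<in> B"
  shows "(restrict f (points Y), restrict g (points Y)) \<in> isotopy_rel Y B"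
proof -
  have "homotopic_with (\<lambda>h. h \<in> B) (subtopology (topo X) (points Y)) (subtopology (topo X) (points Y))
     (restrict f (points Y)) (restrict g (points Y))"
    using fg A YX by (intro homotopic_with_restrict [where P = "\<lambda>h. h \<in> A"]) (auto simp: isotopy_rel_def)
  then show ?thesis
    using fg A by (simp add: isotopy_rel_def flip: topo)
qed

lemma restrict_hom:
  assumes A: "A \<subseteq> Bij (points X)" and B: "B \<subseteq> Bij (points Y)" and YX: "points Y \<subseteq> points X"
    and AB: "\<And>h. h \<in> A \<Longrightarrow> h ` points Y = points Y \<and> restrict h (points Y) \<in> B"
  shows "(\<lambda>f. restrict f (points Y)) \<in> hom (automorphism_group X A) (automorphism_group Y B)"
proof (rule homI)
  show "restrict f (points Y) \<in> carrier (automorphism_group Y B)" if "f \<in> carrier (automorphism_group X A)" for f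
    using that AB by simp
  show "restrict (f \<otimes>\<^bsub>automorphism_group X A\<^esub> g) (points Y) =
      restrict f (points Y) \<otimes>\<^bsub>automorphism_group Y B\<^esub> restrict g (points Y)"
    if "f \<in> carrier (automorphism_group X A)" "g \<in> carrier (automorphism_group X A)" for f g
    using that A B AB restrict_compose [OF YX, of g f] by (simp add: mult_automorphism_group)
qed

section \<open>Isotopies of a disjoint union and the exact sequence\<close>

text \<open>A clopen set has empty frontier, so the two pieces have nothing to agree on.\<close>

lemma continuous_map_clopen_cases:
  assumes S: "openin X S" "closedin X S"
    and f: "continuous_map (subtopology X S) Y f"
    and g: "continuous_map (subtopology X (topspace X - S)) Y g"
  shows "continuous_map X Y (\<lambda>x. if x \<in> S then f x else g x)"
proof (rule continuous_map_cases_alt)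
  have S_eq: "{x \<in> topspace X. x \<in> S} = S" "{x \<in> topspace X. x \<notin> S} = topspace X - S"
    using openin_subset [OF S(1)] by auto
  show "continuous_map (subtopology X (X closure_of {x \<in> topspace X. x \<in> S})) Y f"
    using f S(2) by (simp add: S_eq closure_of_closedin)
  show "continuous_map (subtopology X (X closure_of {x \<in> topspace X. x \<notin> S})) Y g"
    using g S(1) by (simp add: S_eq closure_of_closedin closedin_diff)
  show "f x = g x" if "x \<in> X frontier_of {x \<in> topspace X. x \<in> S}" for x
    using that S frontier_of_eq_empty [OF openin_subset [OF S(1)]] by (simp add: S_eq)
qed

text \<open>Two disjoint closed sets are each clopen in their union, so the isotopy on
  \<open>V\<close> can be glued to the constant one on \<open>W\<close>. Each glued stage is a
  continuous bijection of a compact Hausdorff space, hence a homeomorphism.\<close>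

lemma isotopy_from_id_union:
  assumes X: "compact_space (subtopology X (W \<union> V))" "Hausdorff_space X"
    and W: "closedin X W" and V: "closedin X V" and WV: "disjnt W V"
    and k: "isotopy_from_id (subtopology X V) k"
  shows "isotopy_from_id (subtopology X (W \<union> V)) (\<lambda>(t, x). if x \<in> V then k (t, x) else x)"
proof -
  let ?I = "top_of_set {0..1::real}" and ?Y = "subtopology X (W \<union> V)"
  let ?h = "\<lambda>(t, x). if x \<in> V then k (t, x) else x"
  have sub: "W \<subseteq> topspace X" "V \<subseteq> topspace X"
    using W V closedin_subset by blast+
  have topY: "topspace ?Y = W \<union> V"
    using sub by auto
  have clV: "closedin ?Y V" and clW: "closedin ?Y W"
    using V W by (auto simp: closedin_subtopology)
  have "W \<union> V - W = V"
    using WV by (auto simp: disjnt_iff)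
  then have opV: "openin ?Y V"
    using clW topY by (auto simp: closedin_def)
  have kV: "continuous_map (prod_topology ?I (subtopology X V)) (subtopology X V) k"
    and k_homeo: "\<And>t. t \<in> {0..1} \<Longrightarrow> homeomorphic_map (subtopology X V) (subtopology X V) (\<lambda>x. k (t, x))"
    and k0: "\<And>x. x \<in> V \<Longrightarrow> k (0, x) = x"
    using k sub by (auto simp: isotopy_from_id_def)
  have cont: "continuous_map (prod_topology ?I ?Y) ?Y ?h"
  proof -
    let ?P = "prod_topology ?I ?Y"
    have "subtopology ?P ({0..1} \<times> V) = prod_topology ?I (subtopology X V)"
      by (simp add: subtopology_Times subtopology_subtopology Int_Un_distrib2 Un_Int_eq)
    moreover have "continuous_map (prod_topology ?I (subtopology X V)) ?Y k"
      using kV by (auto simp: continuous_map_in_subtopology)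
    ultimately have 1: "continuous_map (subtopology ?P ({0..1} \<times> V)) ?Y k"
      by simp
    have 2: "continuous_map (subtopology ?P (topspace ?P - {0..1} \<times> V)) ?Y snd"
      by (intro continuous_map_from_subtopology continuous_map_snd)
    have "openin ?P ({0..1} \<times> V)" "closedin ?P ({0..1} \<times> V)"
      using opV clV by (simp_all add: openin_prod_Times_iff closedin_prod_Times_iff)
    from continuous_map_clopen_cases [OF this 1 2] show ?thesis
      by (rule continuous_map_eq) (auto split: if_splits)
  qed
  show ?thesis
    unfolding isotopy_from_id_def
  proof (intro conjI ballI cont)
    fix t :: real assume t: "t \<in> {0..1}"
    have surj: "(\<lambda>x. k (t, x)) ` V = V" and inj: "inj_on (\<lambda>x. k (t, x)) V"
      using homeomorphic_imp_surjective_map [OF k_homeo [OF t]]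
        homeomorphic_imp_injective_map [OF k_homeo [OF t]] sub
      by (simp_all add: Int_absorb1)
    have mem: "k (t, x) \<in> V" if "x \<in> V" for x
      using surj that by blast
    show "homeomorphic_map ?Y ?Y (\<lambda>x. ?h (t, x))"
    proof (rule continuous_imp_homeomorphic_map)
      have "continuous_map ?Y ?Y (?h \<circ> Pair t)"
        by (rule continuous_map_o_Pair [OF cont]) (use t in simp)
      then show "continuous_map ?Y ?Y (\<lambda>x. ?h (t, x))"
        by (simp add: o_def)
      have "(\<lambda>x. ?h (t, x)) ` V = V" "(\<lambda>x. ?h (t, x)) ` W = W"
        using surj WV by (auto simp: disjnt_iff image_iff)
      then show "(\<lambda>x. ?h (t, x)) ` topspace ?Y = topspace ?Y"
        by (simp only: topY image_Un)
      show "inj_on (\<lambda>x. ?h (t, x)) (topspace ?Y)"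
      proof (rule inj_onI)
        fix x y assume "?h (t, x) = ?h (t, y)"
        then show "x = y"
          using mem [of x] mem [of y] inj_onD [OF inj, of x y] by (auto split: if_splits)
      qed
      show "Hausdorff_space ?Y"
        by (rule Hausdorff_space_subtopology [OF X(2)])
    qed (rule X(1))
  next
    show "?h (0, x) = x" for x
      using k0 by simp
  qed
qed

section \<open>Two disjoint submanifolds and their automorphism groups\<close>

locale submanifold_pair =
  fixes M W V :: "'a oriented_space"
  assumes M: "compact_oriented_manifold M"
    and W: "compact_submanifold W M"
    and V: "compact_submanifold V M"
    and WV: "disjnt (points W) (points V)"
begin

abbreviation restrict_both :: "('a \<Rightarrow> 'a) \<Rightarrow> ('a \<Rightarrow> 'a) \<times> ('a \<Rightarrow> 'a)" where
  "restrict_both f \<equiv> (restrict f (points W), restrict f (points V))"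

abbreviation "T \<equiv> triple_automorphisms M W V"
abbreviation "R \<equiv> rel_automorphisms M W V"

lemma orientations:
  "orientation (dimen M) (topo M) (orient M)"
  "orientation (dimen W) (topo W) (orient W)"
  "orientation (dimen V) (topo V) (orient V)"
  using M W V by (simp_all add: compact_submanifold_def compact_oriented_manifold_def)

lemma points_subset: "points W \<subseteq> points M" "points V \<subseteq> points M"
  using W V by (simp_all add: compact_submanifold_def)

lemma topo_eq: "topo W = subtopology (topo M) (points W)" "topo V = subtopology (topo M) (points V)"
  using W V by (simp_all add: compact_submanifold_def)

lemma subgroup_triple: "subgroup T (BijGroup (points M))"
  unfolding triple_automorphisms_def
  by (intro group.subgroups_Inter_pair [OF group_BijGroup] subgroup_pair_automorphisms orientations points_subset)

lemma subgroup_rel: "subgroup R (BijGroup (points M))"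
  by (intro subgroup_rel_automorphisms subgroup_pair_automorphisms orientations points_subset)

lemma triple_automorphismsD:
  assumes "f \<in> T"
  shows "f \<in> automorphisms M"
    "f ` points W = points W" "restrict f (points W) \<in> automorphisms W"
    "f ` points V = points V" "restrict f (points V) \<in> automorphisms V"
  using assms by (simp_all add: triple_automorphisms_def pair_automorphisms_def)

text \<open>The identity on V preserves V and is an automorphism of it, so fixing V pointwise is a
  special case of respecting V. This inclusion is what lets extension by the identity land in
  \<open>Hx2\<close>.\<close>

lemma rel_automorphismsD:
  assumes "f \<in> R"
  shows "f \<in> T" "restrict f (points V) = (\<lambda>x\<in>points V. x)"
proof -
  show f_V: "restrict f (points V) = (\<lambda>x\<in>points V. x)"
    using assms by (auto simp: rel_automorphisms_def)
  have "f ` points V = points V"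
    using assms by (simp add: rel_automorphisms_def)
  then show "f \<in> T"
    using assms f_V subgroup_BijGroupD(2) [OF subgroup_automorphisms [OF orientations(3)]]
    by (simp add: rel_automorphisms_def triple_automorphisms_def pair_automorphisms_def)
qed

sublocale W: group_congruence "automorphism_group W (automorphisms W)" "mcg_rel W"
  by (intro isotopy_rel_congruence subgroup_automorphisms orientations) simp

sublocale V: group_congruence "automorphism_group V (automorphisms V)" "mcg_rel V"
  by (intro isotopy_rel_congruence subgroup_automorphisms orientations) simp

sublocale T: group_congruence "automorphism_group M T" "isotopy_rel M T"
  using triple_automorphismsD(1) by (intro isotopy_rel_congruence subgroup_triple) blast

sublocale R: group_congruence "automorphism_group M R" "isotopy_rel M R"
  using rel_automorphismsD(1) triple_automorphismsD(1) by (intro isotopy_rel_congruence subgroup_rel) blast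

sublocale WV: group_congruence
  "automorphism_group W (automorphisms W) \<times>\<times> automorphism_group V (automorphisms V)" "mcg2_rel W V"
  unfolding mcg2_rel_def
  by (rule group_congruence_DirProd [OF W.group_congruence_axioms V.group_congruence_axioms])

lemma restrict_homs:
  "(\<lambda>f. restrict f (points W)) \<in> hom (automorphism_group M T) (automorphism_group W (automorphisms W))"
  "(\<lambda>f. restrict f (points V)) \<in> hom (automorphism_group M T) (automorphism_group V (automorphisms V))"
  "(\<lambda>f. restrict f (points W)) \<in> hom (automorphism_group M R) (automorphism_group W (automorphisms W))"
proof -
  note Bij = subgroup_BijGroupD(1) [OF subgroup_triple] subgroup_BijGroupD(1) [OF subgroup_rel]
    subgroup_BijGroupD(1) [OF subgroup_automorphisms [OF orientations(2)]]
    subgroup_BijGroupD(1) [OF subgroup_automorphisms [OF orientations(3)]]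
  show "(\<lambda>f. restrict f (points W)) \<in> hom (automorphism_group M T) (automorphism_group W (automorphisms W))"
    "(\<lambda>f. restrict f (points V)) \<in> hom (automorphism_group M T) (automorphism_group V (automorphisms V))"
    "(\<lambda>f. restrict f (points W)) \<in> hom (automorphism_group M R) (automorphism_group W (automorphisms W))"
    by (intro restrict_hom Bij points_subset; simp add: triple_automorphismsD rel_automorphismsD(1))+
qed

lemma restrict_both_hom:
  "restrict_both \<in> hom (automorphism_group M T)
     (automorphism_group W (automorphisms W) \<times>\<times> automorphism_group V (automorphisms V))"
  using restrict_homs(1,2) by (auto simp: hom_def)

lemma restrict_related:
  "(f, g) \<in> isotopy_rel M T \<Longrightarrow> (restrict f (points W), restrict g (points W)) \<in> mcg_rel W"
  "(f, g) \<in> isotopy_rel M T \<Longrightarrow> (restrict f (points V), restrict g (points V)) \<in> mcg_rel V"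
  "(f, g) \<in> isotopy_rel M R \<Longrightarrow> (restrict f (points W), restrict g (points W)) \<in> mcg_rel W"
  by (erule restrict_isotopy_rel; simp add: points_subset topo_eq [symmetric] triple_automorphismsD rel_automorphismsD(1))+

lemma restrict_both_related:
  "(f, g) \<in> isotopy_rel M T \<Longrightarrow> (restrict_both f, restrict_both g) \<in> mcg2_rel W V"
  by (simp add: mcg2_rel_def restrict_related)

section \<open>The three groups as subgroups of mapping class groups\<close>

abbreviation class_W :: "('a \<Rightarrow> 'a) \<Rightarrow> ('a \<Rightarrow> 'a) set" where
  "class_W f \<equiv> mcg_rel W `` {f}"
abbreviation class_V :: "('a \<Rightarrow> 'a) \<Rightarrow> ('a \<Rightarrow> 'a) set" where
  "class_V f \<equiv> mcg_rel V `` {f}"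
abbreviation class_WV :: "('a \<Rightarrow> 'a) \<times> ('a \<Rightarrow> 'a) \<Rightarrow> (('a \<Rightarrow> 'a) \<times> ('a \<Rightarrow> 'a)) set" where
  "class_WV q \<equiv> mcg2_rel W V `` {q}"

text \<open>The carrier is the image of the homomorphism that restriction induces on class groups,
  hence a subgroup. Describing it by representatives in \<open>R\<close> allows later arguments to
  work with automorphisms instead of classes.\<close>

lemma carrier_Hd: "carrier (Hd M W V) = (\<lambda>f. class_W (restrict f (points W))) ` R"
  and subgroup_Hd: "subgroup (carrier (Hd M W V)) (mcg W)"
proof -
  let ?\<rho> = "class_map (mcg_rel W) (\<lambda>f. restrict f (points W))"
  have carrier: "carrier (Hd M W V) = ?\<rho> ` carrier (class_group (automorphism_group M R) (isotopy_rel M R))"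
    by (simp add: Hd_def mcg_pair_rel_def mcg_of_def)
  show "carrier (Hd M W V) = (\<lambda>f. class_W (restrict f (points W))) ` R"
    unfolding carrier R.carrier_class_group image_image carrier_automorphism_group
    by (intro image_cong refl class_map_class [OF R.group_congruence_axioms W.group_congruence_axioms]
        restrict_related(3)) simp_all
  show "subgroup (carrier (Hd M W V)) (mcg W)"
    unfolding carrier mcg_def mcg_of_def
    by (intro subgroup_image_group R.group_class_group W.group_class_group restrict_homs restrict_related
        class_map_hom [OF R.group_congruence_axioms W.group_congruence_axioms])
qed

lemma carrier_Hx1: "carrier (Hx1 M W V) = (\<lambda>f. class_V (restrict f (points V))) ` T"
  and subgroup_Hx1: "subgroup (carrier (Hx1 M W V)) (mcg V)"
proof -
  let ?\<rho> = "class_map (mcg_rel V) (\<lambda>f. restrict f (points V))"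
  have carrier: "carrier (Hx1 M W V) = ?\<rho> ` carrier (class_group (automorphism_group M T) (isotopy_rel M T))"
    by (simp add: Hx1_def mcg_triple_def mcg_of_def)
  show "carrier (Hx1 M W V) = (\<lambda>f. class_V (restrict f (points V))) ` T"
    unfolding carrier T.carrier_class_group image_image carrier_automorphism_group
    by (intro image_cong refl class_map_class [OF T.group_congruence_axioms V.group_congruence_axioms]
        restrict_related(2)) simp_all
  show "subgroup (carrier (Hx1 M W V)) (mcg V)"
    unfolding carrier mcg_def mcg_of_def
    by (intro subgroup_image_group T.group_class_group V.group_class_group restrict_homs restrict_related
        class_map_hom [OF T.group_congruence_axioms V.group_congruence_axioms])
qed

lemma carrier_Hx2: "carrier (Hx2 M W V) = (\<lambda>f. class_WV (restrict_both f)) ` T"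
  and subgroup_Hx2: "subgroup (carrier (Hx2 M W V)) (mcg2 W V)"
proof -
  let ?\<rho> = "class_map (mcg2_rel W V) restrict_both"
  have carrier: "carrier (Hx2 M W V) = ?\<rho> ` carrier (class_group (automorphism_group M T) (isotopy_rel M T))"
    by (simp add: Hx2_def mcg_triple_def mcg_of_def)
  show "carrier (Hx2 M W V) = (\<lambda>f. class_WV (restrict_both f)) ` T"
    unfolding carrier T.carrier_class_group image_image carrier_automorphism_group
    by (intro image_cong refl class_map_class [OF T.group_congruence_axioms WV.group_congruence_axioms]
        restrict_both_related) simp_all
  show "subgroup (carrier (Hx2 M W V)) (mcg2 W V)"
    unfolding carrier mcg2_def
    by (intro subgroup_image_group T.group_class_group WV.group_class_group restrict_both_hom restrict_both_related
        class_map_hom [OF T.group_congruence_axioms WV.group_congruence_axioms])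
qed

lemma group_mcgs: "group (mcg W)" "group (mcg V)" "group (mcg2 W V)"
  using W.group_class_group V.group_class_group WV.group_class_group by (simp_all add: mcg_def mcg_of_def mcg2_def)

lemma groups: "group (Hd M W V)" "group (Hx2 M W V)" "group (Hx1 M W V)"
proof -
  have "Hd M W V = (mcg W)\<lparr>carrier := carrier (Hd M W V)\<rparr>"
    "Hx2 M W V = (mcg2 W V)\<lparr>carrier := carrier (Hx2 M W V)\<rparr>"
    "Hx1 M W V = (mcg V)\<lparr>carrier := carrier (Hx1 M W V)\<rparr>"
    by (simp_all add: Hd_def Hx2_def Hx1_def)
  then show "group (Hd M W V)" "group (Hx2 M W V)" "group (Hx1 M W V)"
    using subgroup.subgroup_is_group [OF subgroup_Hd group_mcgs(1)]
      subgroup.subgroup_is_group [OF subgroup_Hx2 group_mcgs(3)]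
      subgroup.subgroup_is_group [OF subgroup_Hx1 group_mcgs(2)] by simp_all
qed

section \<open>The two maps of the sequence\<close>

lemma id_V: "(\<lambda>x\<in>points V. x) \<in> automorphisms V"
  using subgroup_BijGroupD(2) [OF subgroup_automorphisms [OF orientations(3)]] .

lemma extend_related: "(f, g) \<in> mcg_rel W \<Longrightarrow> ((f, \<lambda>x\<in>points V. x), (g, \<lambda>x\<in>points V. x)) \<in> mcg2_rel W V"
  using V.related_refl [of "\<lambda>x\<in>points V. x"] id_V by (simp add: mcg2_rel_def)

lemma snd_related: "(q, q') \<in> mcg2_rel W V \<Longrightarrow> (snd q, snd q') \<in> mcg_rel V"
  by (auto simp: mcg2_rel_def)

lemma extend_class:
  "f \<in> automorphisms W \<Longrightarrow> extend_by_id W V (class_W f) = class_WV (f, \<lambda>x\<in>points V. x)"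
  unfolding extend_by_id_def
  by (intro class_map_class [OF W.group_congruence_axioms WV.group_congruence_axioms] extend_related) simp_all

lemma restrict_to_snd_class:
  "q \<in> automorphisms W \<times> automorphisms V \<Longrightarrow> restrict_to_snd V (class_WV q) = class_V (snd q)"
  unfolding restrict_to_snd_def
  by (intro class_map_class [OF WV.group_congruence_axioms V.group_congruence_axioms] snd_related) auto

lemma extend_hom: "extend_by_id W V \<in> hom (mcg W) (mcg2 W V)"
  unfolding extend_by_id_def mcg_def mcg_of_def mcg2_def
proof (intro class_map_hom [OF W.group_congruence_axioms WV.group_congruence_axioms] extend_related)
  show "(\<lambda>f. (f, \<lambda>x\<in>points V. x)) \<in> hom (automorphism_group W (automorphisms W))
     (automorphism_group W (automorphisms W) \<times>\<times> automorphism_group V (automorphisms V))"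
    using id_V V.l_one [of "\<lambda>x\<in>points V. x"] by (intro homI) (simp_all add: W.m_closed)
qed

lemma restrict_to_snd_hom: "restrict_to_snd V \<in> hom (mcg2 W V) (mcg V)"
  unfolding restrict_to_snd_def mcg_def mcg_of_def mcg2_def
  by (intro class_map_hom [OF WV.group_congruence_axioms V.group_congruence_axioms] snd_related)
    (auto intro!: homI)

lemma restrict_both_mem: "f \<in> T \<Longrightarrow> restrict_both f \<in> automorphisms W \<times> automorphisms V"
  by (simp add: triple_automorphismsD)

text \<open>An element \<open>f\<close> of \<open>R\<close> restricts to the identity on V, so the
  extension of its restriction to W is realised by \<open>f\<close> itself and is a class coming
  from M.\<close>

lemma extend_Hd:
  assumes "f \<in> R"
  shows "extend_by_id W V (class_W (restrict f (points W))) = class_WV (restrict_both f)"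
  using assms by (simp add: extend_class triple_automorphismsD rel_automorphismsD)

lemma extend_hom_Hd: "extend_by_id W V \<in> hom (Hd M W V) (Hx2 M W V)"
proof (rule homI)
  show "extend_by_id W V C \<in> carrier (Hx2 M W V)" if "C \<in> carrier (Hd M W V)" for C
    using that rel_automorphismsD(1) by (auto simp: carrier_Hd carrier_Hx2 extend_Hd)
  show "extend_by_id W V (C \<otimes>\<^bsub>Hd M W V\<^esub> D) = extend_by_id W V C \<otimes>\<^bsub>Hx2 M W V\<^esub> extend_by_id W V D"
    if "C \<in> carrier (Hd M W V)" "D \<in> carrier (Hd M W V)" for C D
    using hom_mult [OF extend_hom] that subgroup.subset [OF subgroup_Hd]
    by (simp add: Hd_def Hx2_def subset_iff)
qed

lemma restrict_to_snd_hom_Hx2: "restrict_to_snd V \<in> hom (Hx2 M W V) (Hx1 M W V)"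
proof (rule homI)
  show "restrict_to_snd V C \<in> carrier (Hx1 M W V)" if "C \<in> carrier (Hx2 M W V)" for C
    using that restrict_both_mem by (auto simp: carrier_Hx1 carrier_Hx2 restrict_to_snd_class)
  show "restrict_to_snd V (C \<otimes>\<^bsub>Hx2 M W V\<^esub> D) = restrict_to_snd V C \<otimes>\<^bsub>Hx1 M W V\<^esub> restrict_to_snd V D"
    if "C \<in> carrier (Hx2 M W V)" "D \<in> carrier (Hx2 M W V)" for C D
    using hom_mult [OF restrict_to_snd_hom] that subgroup.subset [OF subgroup_Hx2]
    by (simp add: Hx1_def Hx2_def subset_iff)
qed

text \<open>Isotopy of pairs is componentwise, and the second component is the same on both sides;
  equality of the extended classes thus reduces to isotopy of the first components.\<close>

lemma extend_inj: "inj_on (extend_by_id W V) (carrier (Hd M W V))"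
proof (rule inj_onI)
  fix C D assume "C \<in> carrier (Hd M W V)" "D \<in> carrier (Hd M W V)"
    and eq: "extend_by_id W V C = extend_by_id W V D"
  then obtain f g where f: "f \<in> automorphisms W" "C = class_W f" and g: "g \<in> automorphisms W" "D = class_W g"
    using triple_automorphismsD(3) [OF rel_automorphismsD(1)] by (auto simp: carrier_Hd)
  have "((f, \<lambda>x\<in>points V. x), (g, \<lambda>x\<in>points V. x)) \<in> mcg2_rel W V"
    using eq f g id_V by (simp add: extend_class WV.class_eq_iff)
  then show "C = D"
    using f g by (simp add: W.class_eq_iff mcg2_rel_def)
qed

text \<open>Both carriers are parametrized by the same set \<open>T\<close>: the class of
  \<open>restrict_both f\<close> goes to the class of the restriction of \<open>f\<close> to
  V.\<close>

lemma restrict_to_snd_surj: "restrict_to_snd V ` carrier (Hx2 M W V) = carrier (Hx1 M W V)"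
  using restrict_both_mem by (auto simp: carrier_Hx1 carrier_Hx2 restrict_to_snd_class image_image)

section \<open>Exactness in the middle\<close>

lemma isotopy_correction:
  assumes ext: "isotopy_extension (topo M) (points W \<union> points V)" and f: "f \<in> T"
    and iso: "(restrict f (points V), \<lambda>x\<in>points V. x) \<in> mcg_rel V"
  obtains f' where "f' \<in> R" "restrict f' (points W) = restrict f (points W)"
proof -
  let ?I = "top_of_set {0..1::real}" and ?WV = "points W \<union> points V"
  have M_cpt: "compact_space (topo M)" "Hausdorff_space (topo M)"
    using M by (simp_all add: compact_oriented_manifold_def compact_manifold_def)
  have "compact_space (topo W)" "compact_space (topo V)"
    using W V by (simp_all add: compact_submanifold_def compact_oriented_manifold_def compact_manifold_def)
  then have cpt: "compactin (topo M) (points W)" "compactin (topo M) (points V)"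
    using topo_eq points_subset by (simp_all add: compactin_subspace)
  then have closed: "closedin (topo M) (points W)" "closedin (topo M) (points V)"
    by (simp_all add: compactin_imp_closedin M_cpt)
  have cpt_WV: "compact_space (subtopology (topo M) ?WV)"
    using cpt by (simp add: compact_space_subtopology compactin_Un)
  let ?fV = "restrict f (points V)"
  note fT = triple_automorphismsD [OF f]
  obtain k where k: "continuous_map (prod_topology ?I (topo V)) (topo V) k"
      "\<forall>x. k (0, x) = ?fV x" "\<forall>x. k (1, x) = (\<lambda>x\<in>points V. x) x"
    and k_aut: "\<And>t. t \<in> {0..1} \<Longrightarrow> (\<lambda>x. k (t, x)) \<in> automorphisms V"
    using iso by (auto simp: isotopy_rel_def homotopic_with_def)
  define g where "g = inv_into (points V) ?fV"
  have fg: "homeomorphic_maps (topo V) (topo V) ?fV g"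
    unfolding g_def by (rule Bij_homeomorphic_maps) (rule automorphismsD [OF fT(5)])+
  have g: "homeomorphic_map (topo V) (topo V) g" "continuous_map (topo V) (topo V) g"
    and fg_id: "\<And>x. x \<in> points V \<Longrightarrow> g (?fV x) = x" "\<And>x. x \<in> points V \<Longrightarrow> ?fV (g x) = x"
    using fg by (auto simp: homeomorphic_maps_map homeomorphic_imp_continuous_map)
  have g_mem: "g x \<in> points V" if "x \<in> points V" for x
    using homeomorphic_imp_surjective_map [OF g(1)] that by blast
  \<comment> \<open>The given isotopy starts at the restriction of \<open>f\<close>, whereas the
    extension property speaks of isotopies starting at the identity. Precomposing with the inverse
    \<open>g\<close> moves the start to the identity and the end from the identity to
    \<open>g\<close>.\<close>
  have "isotopy_from_id (topo V) (\<lambda>(t, x). k (t, g x))"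
    unfolding isotopy_from_id_def
  proof (intro conjI ballI)
    have "continuous_map (prod_topology ?I (topo V)) (prod_topology ?I (topo V)) (\<lambda>z. (fst z, g (snd z)))"
      using continuous_map_compose [OF continuous_map_snd g(2)]
      by (intro continuous_map_pairedI continuous_map_fst) (simp add: o_def)
    from continuous_map_compose [OF this k(1)]
    show "continuous_map (prod_topology ?I (topo V)) (topo V) (\<lambda>(t, x). k (t, g x))"
      by (simp add: o_def case_prod_unfold)
    show "homeomorphic_map (topo V) (topo V) (\<lambda>x. case (t, x) of (t, x) \<Rightarrow> k (t, g x))" if "t \<in> {0..1}" for t
      using homeomorphic_map_compose [OF g(1) automorphismsD(2) [OF k_aut [OF that]]] by (simp add: o_def)
    show "(case (0, x) of (t, x) \<Rightarrow> k (t, g x)) = x" if "x \<in> points V" for x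
      using k(2) fg_id(2) [OF that] by simp
  qed
  then have "isotopy_from_id (subtopology (topo M) (points V)) (\<lambda>(t, x). k (t, g x))"
    by (simp add: topo_eq(2) [symmetric])
  from isotopy_from_id_union [OF cpt_WV M_cpt(2) closed WV this] ext
  obtain H where H: "isotopy_from_id (topo M) H"
    and H_ext: "\<And>t x. \<lbrakk>t \<in> {0..1}; x \<in> ?WV\<rbrakk> \<Longrightarrow> H (t, x) = (if x \<in> points V then k (t, g x) else x)"
    unfolding isotopy_extension_def by fastforce
  let ?H = "\<lambda>x. H (1, x)"
  have H_W: "H (1, x) = x" if "x \<in> points W" for x
    using H_ext [of 1 x] that WV by (auto simp: disjnt_iff)
  have H_V: "H (1, x) = g x" if "x \<in> points V" for x
    using H_ext [of 1 x] that k(3) g_mem [OF that] by simp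
  \<comment> \<open>Composing after \<open>f\<close> makes the end stage \<open>g\<close> cancel
    \<open>f\<close> on V. On W it acts on points \<open>f x\<close>, which are again in W and hence
    fixed.\<close>
  define f' where "f' = restrict (?H \<circ> f) (points M)"
  have f'_W: "restrict f' (points W) = restrict f (points W)"
  proof (rule restrict_ext)
    fix x assume x: "x \<in> points W"
    then have "f x \<in> points W"
      using fT(2) by blast
    then show "f' x = f x"
      using x points_subset(1) H_W by (simp add: f'_def subset_iff)
  qed
  have "f' \<in> automorphisms M"
    unfolding f'_def using automorphismsD [OF fT(1)] H isotopy_from_id_stage [OF H, of 1]
      isotopy_from_id_orientation_preserving [OF M H, of 1]
    by (intro restrict_automorphismI homeomorphic_map_compose orientation_preserving_compose) simp_all
  moreover have "f' ` points W = points W"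
    using fT(2) f'_W by (metis image_restrict_eq)
  moreover have "f' x = x" if x: "x \<in> points V" for x
  proof -
    have "f x \<in> points V"
      using fT(4) x by blast
    then show ?thesis
      using x points_subset(2) H_V fg_id(1) [OF x] by (simp add: f'_def subset_iff)
  qed
  ultimately have "f' \<in> R"
    using fT(3) f'_W by (simp add: rel_automorphisms_def pair_automorphisms_def)
  then show thesis
    using f'_W that by blast
qed

lemma exact:
  assumes "isotopy_extension (topo M) (points W \<union> points V)"
  shows "extend_by_id W V ` carrier (Hd M W V) = kernel (Hx2 M W V) (Hx1 M W V) (restrict_to_snd V)"
proof (intro equalityI subsetI)
  have one: "\<one>\<^bsub>Hx1 M W V\<^esub> = class_V (\<lambda>x\<in>points V. x)"
    using V.one_class_group by (simp add: Hx1_def mcg_def mcg_of_def)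
  show "C \<in> kernel (Hx2 M W V) (Hx1 M W V) (restrict_to_snd V)"
    if C: "C \<in> extend_by_id W V ` carrier (Hd M W V)" for C
  proof -
    obtain f where f: "f \<in> R" "C = class_WV (restrict_both f)"
      using C by (auto simp: carrier_Hd extend_Hd)
    then have "restrict_to_snd V C = class_V (\<lambda>x\<in>points V. x)"
      using restrict_both_mem [of f] rel_automorphismsD [OF f(1)] id_V by (simp add: restrict_to_snd_class)
    then show ?thesis
      using f rel_automorphismsD(1) by (auto simp: kernel_def one carrier_Hx2)
  qed
  show "C \<in> extend_by_id W V ` carrier (Hd M W V)"
    if C: "C \<in> kernel (Hx2 M W V) (Hx1 M W V) (restrict_to_snd V)" for C
  proof -
    obtain f where f: "f \<in> T" "C = class_WV (restrict_both f)"
      and "restrict_to_snd V C = class_V (\<lambda>x\<in>points V. x)"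
      using C by (auto simp: kernel_def one carrier_Hx2)
    then have iso: "(restrict f (points V), \<lambda>x\<in>points V. x) \<in> mcg_rel V"
      using restrict_both_mem [OF f(1)] id_V by (simp add: restrict_to_snd_class V.class_eq_iff)
    obtain f' where f': "f' \<in> R" "restrict f' (points W) = restrict f (points W)"
      by (rule isotopy_correction [OF assms f(1) iso])
    \<comment> \<open>On W the two automorphisms have equal restrictions. On V the restriction of
      \<open>f'\<close> is the identity, so the required isotopy is the kernel hypothesis
      \<open>iso\<close> itself.\<close>
    have "(restrict_both f, restrict_both f') \<in> mcg2_rel W V"
      using iso W.related_refl triple_automorphismsD(3) [OF f(1)] f'(2) rel_automorphismsD(2) [OF f'(1)]
      by (simp add: mcg2_rel_def)
    then have "C = extend_by_id W V (class_W (restrict f' (points W)))"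
      unfolding f(2) extend_Hd [OF f'(1)] by (rule equiv_class_eq [OF WV.equiv])
    then show ?thesis
      using f'(1) by (auto simp: carrier_Hd)
  qed
qed

end

theorem lemma1p11:
  fixes M W V :: "'a oriented_space"
  assumes "compact_oriented_manifold M"
    and "compact_submanifold W M"
    and "compact_submanifold V M"
    and "disjnt (points W) (points V)"
    and "isotopy_extension (topo M) (points W \<union> points V)"
  shows "short_exact (Hd M W V) (Hx2 M W V) (Hx1 M W V) (extend_by_id W V) (restrict_to_snd V)"
proof -
  interpret submanifold_pair M W V
    by (rule submanifold_pair.intro) (rule assms)+
  show ?thesis
    unfolding short_exact_def group_hom_def group_hom_axioms_def mon_def epi_def
    using groups extend_hom_Hd restrict_to_snd_hom_Hx2 extend_inj restrict_to_snd_surj exact [OF assms(5)]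
    by simp
qed

end
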